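(* Let $\alpha\in(0,1)\cup(1,2)$. Then the Hadamard fractional Brownian motion $B^{\mathcal H}_\alpha$ is locally nondeterministic on any interval $(0,T)$, $T>0$.
   Context: Let $B=\{B(t)\}_{t\ge0}$ be a standard Brownian motion. For $\alpha>0$ the Hadamard fractional Brownian motion is the centered Gaussian process $B^{\mathcal H}_\alpha=\{B^{\mathcal H}_\alpha(t)\}_{t\ge 0}$ given by $B^{\mathcal H}_\alpha(0)=0$ and the Wiener integral $$B^{\mathcal H}_\alpha(t)=\frac1{\sqrt{\Gamma(\alpha)}}\int_0^t\Big(\log\frac ts\Big)^{(\alpha-1)/2}dB(s),\qquad t>0.$$ A zero-mean Gaussian process $X$ is called locally nondeterministic on an interval $\mathbb T=(a,b)$ if: (i) $\mathbb E X^2(t)>0$ for all $t\in\mathbb T$; (ii) $\mathbb E(X(t)-X(s))^2>0$ for all distinct $t,s\in\mathbb T$; (iii) for any integer $m\ge2$, $$\liminf_{\epsilon\downarrow0}\ \frac{\mathrm{Var}\big(X(t_m)-X(t_{m-1})\,\big|\,X(t_1),\dots,X(t_{m-1})\big)}{\mathrm{Var}\big(X(t_m)-X(t_{m-1})\big)}>0,$$ where the $\liminf$ is taken over distinct ordered points $t_1<t_2<\dots<t_m$ in $(a,b)$ with $|t_1-t_m|<\epsilon$ (that is, it is the limit as $\epsilon\downarrow0$ of the infimum of the ratio over all such tuples). The conditional variance of a Gaussian vector is non-random. *)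

theory Defs
  imports "HOL-Probability.Probability"
begin

context prob_space
begin

text \<open>A normal law may be degenerate, that is, have variance zero.\<close>

definition gaussian_rv :: "('a \<Rightarrow> real) \<Rightarrow> bool" where
  "gaussian_rv Y \<longleftrightarrow> random_variable borel Y \<and>
     ((\<exists>\<mu>. AE \<omega> in M. Y \<omega> = \<mu>) \<or>
      (\<exists>\<mu> \<sigma>. \<sigma> > 0 \<and> distributed M lborel Y (normal_density \<mu> \<sigma>)))"

definition gaussian_process :: "real set \<Rightarrow> (real \<Rightarrow> 'a \<Rightarrow> real) \<Rightarrow> bool" where
  "gaussian_process I X \<longleftrightarrow>
     (\<forall>t\<in>I. random_variable borel (X t)) \<and>
     (\<forall>J c. finite J \<and> J \<subseteq> I \<longrightarrow> gaussian_rv (\<lambda>\<omega>. \<Sum>t\<in>J. c t * X t \<omega>))"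

definition centered_gaussian_process :: "real set \<Rightarrow> (real \<Rightarrow> 'a \<Rightarrow> real) \<Rightarrow> bool" where
  "centered_gaussian_process I X \<longleftrightarrow>
     gaussian_process I X \<and> (\<forall>t\<in>I. expectation (X t) = 0)"

text \<open>Processes on the half-line are functions on all reals; values at negative times are irrelevant.\<close>

definition brownian_motion :: "(real \<Rightarrow> 'a \<Rightarrow> real) \<Rightarrow> bool" where
  "brownian_motion B \<longleftrightarrow>
     (\<forall>t\<ge>0. random_variable borel (B t)) \<and>
     (AE \<omega> in M. B 0 \<omega> = 0) \<and>
     (\<forall>n s. 0 \<le> s 0 \<and> strict_mono_on {..n} s \<longrightarrow>
        indep_vars (\<lambda>_. borel) (\<lambda>i \<omega>. B (s (Suc i)) \<omega> - B (s i) \<omega>) {..<n::nat}) \<and>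
     (\<forall>s t. 0 \<le> s \<and> s < t \<longrightarrow>
        distributed M lborel (\<lambda>\<omega>. B t \<omega> - B s \<omega>) (normal_density 0 (sqrt (t - s)))) \<and>
     (AE \<omega> in M. continuous_on {0..} (\<lambda>t. B t \<omega>))"

text \<open>The step function \<open>\<Sum>i<n. c i * 1\<^bsub>(s i, s (i+1)]\<^esub>\<close> and its integral with respect to \<open>B\<close>.\<close>

definition step_fun :: "nat \<Rightarrow> (nat \<Rightarrow> real) \<Rightarrow> (nat \<Rightarrow> real) \<Rightarrow> real \<Rightarrow> real" where
  "step_fun n s c x = (\<Sum>i<n. c i * indicator {s i<..s (Suc i)} x)"

definition step_integral ::
    "(real \<Rightarrow> 'a \<Rightarrow> real) \<Rightarrow> nat \<Rightarrow> (nat \<Rightarrow> real) \<Rightarrow> (nat \<Rightarrow> real) \<Rightarrow> 'a \<Rightarrow> real" where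
  "step_integral B n s c \<omega> = (\<Sum>i<n. c i * (B (s (Suc i)) \<omega> - B (s i) \<omega>))"

text \<open>
  \<open>has_wiener_integral B f t Y\<close>: the random variable \<open>Y\<close> is a version of the Wiener integral of
  \<open>f\<close> over \<open>[0, t]\<close> with respect to \<open>B\<close>. For square-integrable \<open>f\<close> it is the mean-square limit
  of the integrals of step functions converging to \<open>f\<close> in \<open>L2\<close>. By the Ito isometry it does not
  depend, up to null sets, on the approximating sequence.
\<close>

definition has_wiener_integral ::
    "(real \<Rightarrow> 'a \<Rightarrow> real) \<Rightarrow> (real \<Rightarrow> real) \<Rightarrow> real \<Rightarrow> ('a \<Rightarrow> real) \<Rightarrow> bool" where
  "has_wiener_integral B f t Y \<longleftrightarrow>
     set_borel_measurable lborel {0..t} f \<and>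
     set_integrable lborel {0..t} (\<lambda>s. (f s)\<^sup>2) \<and>
     random_variable borel Y \<and>
     (\<exists>(n :: nat \<Rightarrow> nat) s c.
        (\<forall>k. 0 \<le> s k 0 \<and> strict_mono_on {..n k} (s k) \<and> s k (n k) \<le> t) \<and>
        (\<lambda>k. \<integral>\<^sup>+x\<in>{0..t}. ennreal ((f x - step_fun (n k) (s k) (c k) x)\<^sup>2) \<partial>lborel)
          \<longlonglongrightarrow> 0 \<and>
        (\<lambda>k. \<integral>\<^sup>+\<omega>. ennreal ((Y \<omega> - step_integral B (n k) (s k) (c k) \<omega>)\<^sup>2) \<partial>M)
          \<longlonglongrightarrow> 0)"

text \<open>
  The Wiener integrals are only determined almost surely, hence a predicate: \<open>X\<close> is the Hadamard
  fractional Brownian motion driven by \<open>B\<close>, for some choice of versions.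
  The value of the integrand at \<open>s = 0\<close> (a null set) is immaterial.
\<close>

definition hadamard_fbm ::
    "real \<Rightarrow> (real \<Rightarrow> 'a \<Rightarrow> real) \<Rightarrow> (real \<Rightarrow> 'a \<Rightarrow> real) \<Rightarrow> bool" where
  "hadamard_fbm \<alpha> B X \<longleftrightarrow>
     (\<forall>\<omega>\<in>space M. X 0 \<omega> = 0) \<and>
     (\<forall>t>0. \<exists>Y. has_wiener_integral B (\<lambda>s. ln (t / s) powr ((\<alpha> - 1) / 2)) t Y \<and>
        (\<forall>\<omega>\<in>space M. X t \<omega> = 1 / sqrt (Gamma \<alpha>) * Y \<omega>))"

definition generated_algebra :: "'i set \<Rightarrow> ('i \<Rightarrow> 'a \<Rightarrow> real) \<Rightarrow> 'a measure" where
  "generated_algebra J Z =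
     vimage_algebra (space M) (\<lambda>\<omega>. \<lambda>j\<in>J. Z j \<omega>) (\<Pi>\<^sub>M j\<in>J. borel)"

definition cond_variance :: "'a measure \<Rightarrow> ('a \<Rightarrow> real) \<Rightarrow> 'a \<Rightarrow> real" where
  "cond_variance F Y = real_cond_exp M F (\<lambda>\<omega>. (Y \<omega> - real_cond_exp M F Y \<omega>)\<^sup>2)"

text \<open>For jointly Gaussian variables the conditional variance is almost surely constant; this is
  that constant.\<close>

definition gaussian_cond_variance :: "'i set \<Rightarrow> ('i \<Rightarrow> 'a \<Rightarrow> real) \<Rightarrow> ('a \<Rightarrow> real) \<Rightarrow> real" where
  "gaussian_cond_variance J Z Y =
     (THE v. AE \<omega> in M. cond_variance (generated_algebra J Z) Y \<omega> = v)"

definition lnd_ratio :: "(real \<Rightarrow> 'a \<Rightarrow> real) \<Rightarrow> nat \<Rightarrow> (nat \<Rightarrow> real) \<Rightarrow> real" where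
  "lnd_ratio X m \<tau> =
     gaussian_cond_variance {1..m-1} (\<lambda>i. X (\<tau> i)) (\<lambda>\<omega>. X (\<tau> m) \<omega> - X (\<tau> (m-1)) \<omega>) /
     variance (\<lambda>\<omega>. X (\<tau> m) \<omega> - X (\<tau> (m-1)) \<omega>)"

definition close_tuples :: "nat \<Rightarrow> real \<Rightarrow> real \<Rightarrow> real \<Rightarrow> (nat \<Rightarrow> real) set" where
  "close_tuples m a b \<epsilon> =
     {\<tau>. strict_mono_on {1..m} \<tau> \<and> \<tau> ` {1..m} \<subseteq> {a<..<b} \<and> \<bar>\<tau> 1 - \<tau> m\<bar> < \<epsilon>}"

text \<open>
  Local nondeterminism on \<open>(a, b)\<close> of a process indexed by \<open>I\<close>. The infimum over tuples increases
  as \<open>\<epsilon>\<close> decreases, so its lower limit as \<open>\<epsilon>\<close> tends to zero from above is a limit; it is taken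
  in the extended reals.
\<close>

definition locally_nondeterministic ::
    "real set \<Rightarrow> (real \<Rightarrow> 'a \<Rightarrow> real) \<Rightarrow> real \<Rightarrow> real \<Rightarrow> bool" where
  "locally_nondeterministic I X a b \<longleftrightarrow>
     {a<..<b} \<subseteq> I \<and>
     centered_gaussian_process I X \<and>
     (\<forall>t\<in>{a<..<b}. expectation (\<lambda>\<omega>. (X t \<omega>)\<^sup>2) > 0) \<and>
     (\<forall>t\<in>{a<..<b}. \<forall>s\<in>{a<..<b}. t \<noteq> s \<longrightarrow> expectation (\<lambda>\<omega>. (X t \<omega> - X s \<omega>)\<^sup>2) > 0) \<and>
     (\<forall>m\<ge>2. Liminf (at_right 0) (\<lambda>\<epsilon>. INF \<tau>\<in>close_tuples m a b \<epsilon>. ereal (lnd_ratio X m \<tau>)) > 0)"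

end

end

theory Submission
  imports Defs "HOL-Real_Asymp.Real_Asymp"
begin

text \<open>
  For \<open>0 < s < t\<close> the variable \<open>X t\<close> contains the innovation brought by \<open>B\<close> on \<open>(s, t)\<close>, whose variance is
  \<open>A(s, t) = 1 / \<Gamma>(\<alpha>) * \<integral>\<^sub>s\<^sup>t (ln (t / u)) powr (\<alpha> - 1) du\<close>. Nothing that depends on \<open>B\<close> up to time \<open>s\<close>
  predicts it. Local nondeterminism holds because \<open>A(s, t)\<close> is at least a fixed fraction, which depends
  on \<open>\<alpha>\<close> only, of the variance of \<open>X t - X s\<close> (\<open>hadamard_increment_le_innovation\<close>). The ratio in the
  definition is therefore bounded below for all ordered tuples, close to each other or not, and
  however close to \<open>0\<close>.

  To compare the two, write \<open>h = ln (t / s)\<close>. The variance of \<open>X t - X s\<close> is \<open>A(s, t)\<close> plus the energy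
  of the change of the kernel on \<open>(0, s)\<close>. With \<open>u = s exp (- y)\<close> the latter is, up to the factor
  \<open>s / \<Gamma>(\<alpha>)\<close>, at most the integral of \<open>((y + h) powr \<beta> - y powr \<beta>)\<^sup>2\<close> over \<open>y > 0\<close>, where
  \<open>\<beta> = (\<alpha> - 1) / 2\<close>. This is a constant times \<open>h powr \<alpha>\<close>; the constant is finite because \<open>\<alpha> > 0\<close>
  makes \<open>y powr (\<alpha> - 1)\<close> integrable at \<open>0\<close> and \<open>\<alpha> < 2\<close> makes \<open>y powr (\<alpha> - 3)\<close> integrable at infinity.
  On the other side, \<open>A(s, t)\<close> is at least \<open>s / \<Gamma>(\<alpha>) * h powr \<alpha> / \<alpha>\<close>. All these integrals have
  explicit antiderivatives in terms of \<open>ln (r / u)\<close>, so no change of variables is made.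

  The probabilistic part translates variances and conditional variances into integrals of kernels.
  A Wiener integral is handled together with its kernel (\<open>wiener_pair\<close>). The pairs form a linear
  relation, and the variable is centered normal with the squared norm of the kernel as its variance:
  this is the independence of the increments of \<open>B\<close> for step functions, and it passes to limits through
  characteristic functions. Consequently orthogonal kernels belong to independent variables; the
  passage from characteristic functions to independence of a whole vector is the theorem of Cramer
  and Wold (\<open>determining_PiM\<close>). The conditional variance is therefore the squared distance of a kernel
  from the span of others (\<open>gaussian_cond_variance_wiener\<close>). The kernels of the past vanish on
  \<open>(s, t)\<close>, so this distance is at least \<open>A(s, t)\<close>.
\<close>

section \<open>Square-integrable functions\<close>

definition square_integrable :: "'b measure \<Rightarrow> ('b \<Rightarrow> real) \<Rightarrow> bool" where
  "square_integrable M f \<longleftrightarrow> f \<in> borel_measurable M \<and> integrable M (\<lambda>x. (f x)\<^sup>2)"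

lemma square_integrable_mult:
  assumes "square_integrable M f" "square_integrable M g"
  shows "integrable M (\<lambda>x. f x * g x)"
proof (rule Bochner_Integration.integrable_bound)
  show "integrable M (\<lambda>x. (f x)\<^sup>2 + (g x)\<^sup>2)"
    using assms by (auto simp: square_integrable_def)
  show "(\<lambda>x. f x * g x) \<in> borel_measurable M"
    using assms by (auto simp: square_integrable_def)
  have "\<bar>a * b\<bar> \<le> a\<^sup>2 + b\<^sup>2" for a b :: real
    using sum_squares_bound[of "\<bar>a\<bar>" "\<bar>b\<bar>"] abs_ge_zero[of "a * b"]
    unfolding abs_mult power2_abs by linarith
  then show "AE x in M. norm (f x * g x) \<le> norm ((f x)\<^sup>2 + (g x)\<^sup>2)"
    by (intro AE_I2) simp
qed

lemma square_integrable_0 [simp]: "square_integrable M (\<lambda>x. 0)"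
  by (simp add: square_integrable_def)

lemma square_integrable_scale:
  "square_integrable M f \<Longrightarrow> square_integrable M (\<lambda>x. a * f x)"
  by (auto simp: square_integrable_def power_mult_distrib)

lemma square_integrable_add:
  assumes "square_integrable M f" "square_integrable M g"
  shows "square_integrable M (\<lambda>x. f x + g x)"
  using assms square_integrable_mult[OF assms]
    integrable_mult_right[OF square_integrable_mult[OF assms], of 2]
  by (auto simp: square_integrable_def power2_sum mult.assoc)

lemma square_integrable_diff:
  assumes "square_integrable M f" "square_integrable M g"
  shows "square_integrable M (\<lambda>x. f x - g x)"
  using square_integrable_add[OF assms(1) square_integrable_scale[OF assms(2), of "-1"]] by simp

lemma square_integrable_sum:
  assumes "\<And>i. i \<in> I \<Longrightarrow> square_integrable M (f i)"
  shows "square_integrable M (\<lambda>x. \<Sum>i\<in>I. c i * f i x)"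
  using assms
  by (induction I rule: infinite_finite_induct)
     (auto intro!: square_integrable_add square_integrable_scale)

text \<open>
  Orthogonal projection on the span of finitely many functions, by Gram--Schmidt: the induction
  step subtracts from the residual of \<open>y\<close> its component along the residual of the new function.
  The \<open>z j\<close> may be linearly dependent; the residual of the new function is then null almost
  everywhere, and the quotient by its squared norm is \<open>0\<close>, as division by zero gives \<open>0\<close>.
\<close>

lemma orthogonal_residual_exists:
  assumes "finite J" "\<And>j. j \<in> J \<Longrightarrow> square_integrable M (z j)" "square_integrable M y"
  shows "\<exists>c. \<forall>i\<in>J. (\<integral>x. (y x - (\<Sum>j\<in>J. c j * z j x)) * z i x \<partial>M) = 0"
  using assms
proof (induction J arbitrary: y rule: finite_induct)
  case (insert k J)
  have zJ: "square_integrable M (z j)" if "j \<in> J" for j using insert.prems that by auto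
  have zk: "square_integrable M (z k)" using insert.prems by auto
  obtain d where d: "\<And>i. i \<in> J \<Longrightarrow> (\<integral>x. (z k x - (\<Sum>j\<in>J. d j * z j x)) * z i x \<partial>M) = 0"
    using insert.IH[OF zJ zk] by blast
  obtain c where c: "\<And>i. i \<in> J \<Longrightarrow> (\<integral>x. (y x - (\<Sum>j\<in>J. c j * z j x)) * z i x \<partial>M) = 0"
    using insert.IH[OF zJ insert.prems(2)] by blast
  define R where "R = (\<lambda>x. z k x - (\<Sum>j\<in>J. d j * z j x))"
  define V where "V = (\<lambda>x. y x - (\<Sum>j\<in>J. c j * z j x))"
  have R: "square_integrable M R" and V: "square_integrable M V"
    unfolding R_def V_def
    by (auto intro!: square_integrable_diff square_integrable_sum zJ zk insert.prems(2))
  define l where "l = (\<integral>x. V x * R x \<partial>M) / (\<integral>x. R x * R x \<partial>M)"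
  define W where "W = (\<lambda>x. V x - l * R x)"
  have W: "square_integrable M W"
    unfolding W_def by (intro square_integrable_diff square_integrable_scale R V)
  have WJ: "(\<integral>x. W x * z i x \<partial>M) = 0" if "i \<in> J" for i
  proof -
    have "(\<integral>x. W x * z i x \<partial>M) = (\<integral>x. V x * z i x - l * (R x * z i x) \<partial>M)"
      by (simp add: W_def algebra_simps)
    also have "\<dots> = (\<integral>x. V x * z i x \<partial>M) - l * (\<integral>x. R x * z i x \<partial>M)"
      using square_integrable_mult[OF V zJ[OF that]] square_integrable_mult[OF R zJ[OF that]]
      by simp
    finally show ?thesis using c[OF that] d[OF that] by (simp add: V_def R_def)
  qed
  have WR: "(\<integral>x. W x * R x \<partial>M) = 0"
  proof -
    have "(\<integral>x. W x * R x \<partial>M) = (\<integral>x. V x * R x - l * (R x * R x) \<partial>M)"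
      by (simp add: W_def algebra_simps)
    also have "\<dots> = (\<integral>x. V x * R x \<partial>M) - l * (\<integral>x. R x * R x \<partial>M)"
      using square_integrable_mult[OF V R] square_integrable_mult[OF R R] by simp
    also have "\<dots> = 0"
    proof (cases "(\<integral>x. R x * R x \<partial>M) = 0")
      case True
      then have "AE x in M. R x * R x = 0"
        using square_integrable_mult[OF R R] integral_nonneg_eq_0_iff_AE[of M "\<lambda>x. R x * R x"]
        by simp
      then have "(\<integral>x. V x * R x \<partial>M) = (\<integral>x. 0 \<partial>M)"
        using R V by (intro integral_cong_AE) (auto simp: square_integrable_def)
      then show ?thesis using True by simp
    qed (simp add: l_def)
    finally show ?thesis .
  qed
  have Wk: "(\<integral>x. W x * z k x \<partial>M) = 0"
  proof -
    have "(\<integral>x. W x * z k x \<partial>M) = (\<integral>x. W x * R x + (\<Sum>j\<in>J. d j * (W x * z j x)) \<partial>M)"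
      by (simp add: R_def algebra_simps sum_distrib_left)
    also have "\<dots> = (\<integral>x. W x * R x \<partial>M) + (\<Sum>j\<in>J. d j * (\<integral>x. W x * z j x \<partial>M))"
      using square_integrable_mult[OF W R] square_integrable_mult[OF W zJ] by simp
    finally show ?thesis using WR WJ by simp
  qed
  define e where "e = (\<lambda>j. if j = k then l else c j - l * d j)"
  have "(\<Sum>j\<in>insert k J. e j * z j x) = l * z k x + (\<Sum>j\<in>J. (c j - l * d j) * z j x)" for x
    using insert.hyps unfolding e_def by (simp, intro sum.cong) auto
  then have "y x - (\<Sum>j\<in>insert k J. e j * z j x) = W x" for x
    by (simp add: W_def V_def R_def algebra_simps sum_subtractf sum_distrib_left)
  then show ?case using WJ Wk by (intro exI[of _ e]) auto
qed simp

text \<open>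
  Convergence in \<open>L2\<close> implies convergence of the norms: Young's inequality bounds the difference
  of the squared norms by \<open>\<eta> \<parallel>f\<parallel>\<^sup>2 + (1 + 1/\<eta>) \<parallel>f - g k\<parallel>\<^sup>2\<close> for every \<open>\<eta> > 0\<close>.
\<close>

lemma square_integral_tendsto:
  assumes f: "square_integrable M f" and g: "\<And>k. square_integrable M (g k)"
    and lim: "(\<lambda>k::nat. \<integral>\<^sup>+x. ennreal ((f x - g k x)\<^sup>2) \<partial>M) \<longlonglongrightarrow> 0"
  shows "(\<lambda>k. \<integral>x. (g k x)\<^sup>2 \<partial>M) \<longlonglongrightarrow> (\<integral>x. (f x)\<^sup>2 \<partial>M)"
proof (rule LIMSEQ_I)
  define F where "F = (\<integral>x. (f x)\<^sup>2 \<partial>M)"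
  define D where "D k = (\<integral>x. (f x - g k x)\<^sup>2 \<partial>M)" for k
  have D: "square_integrable M (\<lambda>x. f x - g k x)" for k
    by (intro square_integrable_diff f g)
  have "(\<lambda>k. ennreal (D k)) \<longlonglongrightarrow> ennreal 0"
    using lim D unfolding D_def by (subst (asm) nn_integral_eq_integral) (auto
      simp: square_integrable_def)
  then have Dlim: "D \<longlonglongrightarrow> 0"
    by (subst (asm) tendsto_ennreal_iff) (auto simp: D_def)
  have F0: "F \<ge> 0" by (simp add: F_def)
  fix r :: real assume r: "r > 0"
  \<comment> \<open>The \<open>+ 1\<close> keeps the denominator positive when \<open>f\<close> is null.\<close>
  define \<eta> where "\<eta> = r / (2 * (F + 1))"
  have \<eta>: "\<eta> > 0" and \<eta>F: "\<eta> * F < r / 2"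
    using r F0 by (auto simp: \<eta>_def field_simps)
  have "(\<lambda>k. (1 + 1/\<eta>) * D k) \<longlonglongrightarrow> (1 + 1/\<eta>) * 0"
    by (intro tendsto_intros Dlim)
  then have "\<forall>\<^sub>F k in sequentially. (1 + 1/\<eta>) * D k < r / 2"
    using r by (intro order_tendstoD) auto
  moreover have "\<bar>(\<integral>x. (g k x)\<^sup>2 \<partial>M) - F\<bar> \<le> \<eta> * F + (1 + 1/\<eta>) * D k" for k
  proof -
    have pw: "\<bar>b\<^sup>2 - a\<^sup>2\<bar> \<le> \<eta> * a\<^sup>2 + (1 + 1/\<eta>) * (a - b)\<^sup>2" for a b :: real
    proof -
      have 1: "\<eta> * (2 * \<bar>a * (a-b)\<bar>) \<le> \<eta> * (\<eta> * a\<^sup>2 + (a-b)\<^sup>2/\<eta>)"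
        using sum_squares_bound[of "\<eta> * \<bar>a\<bar>" "\<bar>a - b\<bar>"] \<eta>
        by (simp add: abs_mult power_mult_distrib distrib_left power2_eq_square mult_ac)
      have 2: "2 * \<bar>a * (a-b)\<bar> \<le> \<eta> * a\<^sup>2 + (a-b)\<^sup>2/\<eta>"
        using 1 \<eta> by (rule mult_left_le_imp_le)
      have "b\<^sup>2 - a\<^sup>2 = (a-b)\<^sup>2 - 2 * (a * (a-b))"
        by (simp add: power2_eq_square algebra_simps)
      then have "\<bar>b\<^sup>2 - a\<^sup>2\<bar> \<le> (a-b)\<^sup>2 + 2 * \<bar>a * (a-b)\<bar>"
        using zero_le_power2[of "a-b"] by linarith
      with 2 show ?thesis by (simp add: algebra_simps)
    qed
    have "(\<integral>x. (g k x)\<^sup>2 \<partial>M) - F = (\<integral>x. (g k x)\<^sup>2 - (f x)\<^sup>2 \<partial>M)"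
      unfolding F_def using f g by (subst Bochner_Integration.integral_diff) (auto
        simp: square_integrable_def)
    also have "\<bar>\<dots>\<bar> \<le> (\<integral>x. \<bar>(g k x)\<^sup>2 - (f x)\<^sup>2\<bar> \<partial>M)"
      by (rule integral_abs_bound)
    also have "\<dots> \<le> (\<integral>x. \<eta> * (f x)\<^sup>2 + (1 + 1/\<eta>) * (f x - g k x)\<^sup>2 \<partial>M)"
      using pw f g[of k] D[of k] by (intro integral_mono) (auto simp: square_integrable_def)
    also have "\<dots> = \<eta> * F + (1 + 1/\<eta>) * D k"
      using f D[of k] by (simp add: F_def D_def square_integrable_def)
    finally show ?thesis .
  qed
  ultimately have "\<forall>\<^sub>F k in sequentially. norm ((\<integral>x. (g k x)\<^sup>2 \<partial>M) - F) < r"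
    using \<eta>F by (auto elim!: eventually_mono) (smt (verit))
  then show "\<exists>no. \<forall>n\<ge>no. norm ((\<integral>x. (g n x)\<^sup>2 \<partial>M) - (\<integral>x. (f x)\<^sup>2 \<partial>M)) < r"
    by (simp add: eventually_sequentially F_def)
qed

section \<open>Characteristic functions and independence\<close>

text \<open>
  Levy's uniqueness theorem without the normalisation: the characteristic function at \<open>0\<close> is the
  total mass, so that both measures can be divided by the same constant.
\<close>

lemma finite_measure_char_eqI:
  fixes \<mu> \<nu> :: "real measure"
  assumes "finite_measure \<mu>" "finite_measure \<nu>" and sets: "sets \<mu> = sets borel" "sets \<nu> = sets borel"
    and char_eq: "\<And>u. (\<integral>x. iexp (u * x) \<partial>\<mu>) = (\<integral>x. iexp (u * x) \<partial>\<nu>)"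
  shows "\<mu> = \<nu>"
proof -
  interpret \<mu>: finite_measure \<mu> by fact
  interpret \<nu>: finite_measure \<nu> by fact
  have space: "space \<mu> = UNIV" "space \<nu> = UNIV"
    using sets_eq_imp_space_eq[OF sets(1)] sets_eq_imp_space_eq[OF sets(2)] by auto
  define c where "c = measure \<mu> UNIV"
  have c\<nu>: "measure \<nu> UNIV = c"
    using char_eq[of 0] space by (simp add: c_def)
  have em: "emeasure \<mu> UNIV = ennreal c" "emeasure \<nu> UNIV = ennreal c"
    using c\<nu> by (simp_all add: \<mu>.emeasure_eq_measure \<nu>.emeasure_eq_measure c_def)
  show ?thesis
  proof (cases "c = 0")
    case True
    have "emeasure \<mu> A = 0" "emeasure \<nu> A = 0" for A
      using em True emeasure_space[of \<mu> A] emeasure_space[of \<nu> A] space by auto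
    then show ?thesis using sets by (intro measure_eqI) auto
  next
    case False
    then have c: "c > 0" by (simp add: c_def less_le)
    have dist: "real_distribution (density \<rho> (\<lambda>_. ennreal (1/c)))"
      if "sets \<rho> = sets borel" "emeasure \<rho> UNIV = ennreal c" for \<rho> :: "real measure"
    proof -
      have "space \<rho> = UNIV" using sets_eq_imp_space_eq[OF that(1)] by simp
      then have "prob_space (density \<rho> (\<lambda>_. ennreal (1/c)))"
        using c that by (intro prob_spaceI) (simp add: emeasure_density_const ennreal_mult[symmetric])
      then show ?thesis
        using that by (simp add: real_distribution_def real_distribution_axioms_def)
    qed
    have ch: "char (density \<rho> (\<lambda>_. ennreal (1/c))) u = (1/c) *\<^sub>R (\<integral>x. iexp (u * x) \<partial>\<rho>)"
      if [measurable_cong]: "sets \<rho> = sets borel" for \<rho> :: "real measure" and u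
      unfolding char_def using c by (subst integral_density) auto
    have eq: "density \<mu> (\<lambda>_. ennreal (1/c)) = density \<nu> (\<lambda>_. ennreal (1/c))"
      using dist[OF sets(1) em(1)] dist[OF sets(2) em(2)]
      by (rule Levy_uniqueness) (simp only: fun_eq_iff ch[OF sets(1)] ch[OF sets(2)] char_eq simp_thms)
    show ?thesis
    proof (rule measure_eqI)
      fix A assume A: "A \<in> sets \<mu>"
      have "ennreal (1/c) * emeasure \<mu> A = ennreal (1/c) * emeasure \<nu> A"
        using arg_cong[OF eq, of "\<lambda>m. emeasure m A"] A sets
        by (simp add: emeasure_density_const)
      then have "(ennreal c * ennreal (1/c)) * emeasure \<mu> A
        = (ennreal c * ennreal (1/c)) * emeasure \<nu> A"
        by (simp only: mult.assoc)
      then show "emeasure \<mu> A = emeasure \<nu> A"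
        using c by (simp add: ennreal_mult[symmetric])
    qed (simp add: sets)
  qed
qed

text \<open>
  Uniqueness for characteristic functions in several dimensions is proved one real coordinate at a
  time. The induction needs a notion that also makes sense for the remaining coordinates together:
  a set \<open>\<Phi>\<close> of phases such that the integrals of \<open>exp (\<i> \<phi>)\<close>, \<open>\<phi> \<in> \<Phi>\<close>, separate finite measures.
  The zero phase is included because it is the one that yields the law of a single coordinate.
  Measures that are not probability measures arise as restrictions to an event.
\<close>

definition determining :: "'b measure \<Rightarrow> ('b \<Rightarrow> real) set \<Rightarrow> bool" where
  "determining S \<Phi> \<longleftrightarrow> \<Phi> \<subseteq> borel_measurable S \<and> (\<lambda>_. 0) \<in> \<Phi> \<and>
     (\<forall>\<mu> \<nu>. finite_measure \<mu> \<and> finite_measure \<nu> \<and> sets \<mu> = sets S \<and> sets \<nu> = sets S \<and>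
        (\<forall>\<phi>\<in>\<Phi>. (\<integral>x. iexp (\<phi> x) \<partial>\<mu>) = (\<integral>x. iexp (\<phi> x) \<partial>\<nu>)) \<longrightarrow> \<mu> = \<nu>)"

lemma determiningD:
  assumes "determining S \<Phi>" "finite_measure \<mu>" "finite_measure \<nu>" "sets \<mu> = sets S" "sets \<nu> = sets S"
    "\<And>\<phi>. \<phi> \<in> \<Phi> \<Longrightarrow> (\<integral>x. iexp (\<phi> x) \<partial>\<mu>) = (\<integral>x. iexp (\<phi> x) \<partial>\<nu>)"
  shows "\<mu> = \<nu>"
  using assms unfolding determining_def by blast

text \<open>
  A bounded nonnegative weight \<open>g\<close> turns the first marginal into another finite measure on the line,
  to which the one-dimensional uniqueness theorem applies.
\<close>

lemma weighted_first_marginal_eq: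
  fixes g :: "real \<times> 'b \<Rightarrow> real"
  assumes "finite_measure \<mu>" "finite_measure \<nu>"
    and sets[measurable_cong]: "sets \<mu> = sets (borel \<Otimes>\<^sub>M S)" "sets \<nu> = sets (borel \<Otimes>\<^sub>M S)"
    and g[measurable]: "g \<in> borel_measurable (borel \<Otimes>\<^sub>M S)"
    and bd: "\<And>z. 0 \<le> g z" "\<And>z. g z \<le> 2"
    and eq: "\<And>u. (\<integral>z. g z *\<^sub>R iexp (u * fst z) \<partial>\<mu>) = (\<integral>z. g z *\<^sub>R iexp (u * fst z) \<partial>\<nu>)"
    and B[measurable]: "B \<in> sets borel"
  shows "(\<integral>z. g z * indicator B (fst z) \<partial>\<mu>) = (\<integral>z. g z * indicator B (fst z) \<partial>\<nu>)"
proof -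
  have fin: "finite_measure (distr (density \<rho> g) borel fst)"
    if "finite_measure \<rho>" and [measurable_cong]: "sets \<rho> = sets (borel \<Otimes>\<^sub>M S)"
    for \<rho> :: "(real \<times> 'b) measure"
  proof -
    interpret finite_measure \<rho> by fact
    have "(\<integral>\<^sup>+z. ennreal (g z) \<partial>\<rho>) \<le> (\<integral>\<^sup>+z. ennreal 2 \<partial>\<rho>)"
      by (intro nn_integral_mono ennreal_leI bd)
    also have "\<dots> < \<infinity>" by (simp add: emeasure_eq_measure ennreal_mult_less_top)
    finally have "(\<integral>\<^sup>+z. ennreal (g z) \<partial>\<rho>) < \<infinity>" .
    then have "emeasure (density \<rho> g) (space \<rho>) \<noteq> \<infinity>"
      by (subst emeasure_density) (auto cong: nn_integral_cong)
    then have "finite_measure (density \<rho> g)" by (intro finite_measureI) simp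
    then show ?thesis by (rule finite_measure.finite_measure_distr) measurable
  qed
  have "distr (density \<mu> g) borel fst = distr (density \<nu> g) borel fst"
  proof (rule finite_measure_char_eqI)
    fix u
    have "(\<integral>x. iexp (u * x) \<partial>distr (density \<rho> g) borel fst) = (\<integral>z. g z *\<^sub>R iexp (u * fst z) \<partial>\<rho>)"
      if [measurable_cong]: "sets \<rho> = sets (borel \<Otimes>\<^sub>M S)" for \<rho> :: "(real \<times> 'b) measure"
      using bd by (subst integral_distr, measurable) (subst integral_density, auto)
    then show "(\<integral>x. iexp (u * x) \<partial>distr (density \<mu> g) borel fst) =
        (\<integral>x. iexp (u * x) \<partial>distr (density \<nu> g) borel fst)"
      using eq sets by simp
  qed (simp_all add: fin assms)
  then have "(\<integral>x. indicator B x \<partial>distr (density \<mu> g) borel fst) =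
      (\<integral>x. indicator B x \<partial>distr (density \<nu> g) borel fst :: real)" by simp
  moreover have "(\<integral>x. indicator B x \<partial>distr (density \<rho> g) borel fst :: real)
      = (\<integral>z. g z * indicator B (fst z) \<partial>\<rho>)"
    if [measurable_cong]: "sets \<rho> = sets (borel \<Otimes>\<^sub>M S)" for \<rho> :: "(real \<times> 'b) measure"
    using bd by (subst integral_distr, measurable) (subst integral_density, auto)
  ultimately show ?thesis using sets by simp
qed

text \<open>
  Take the weights \<open>1\<close>, \<open>1 + cos \<phi>\<close> and \<open>1 + sin \<phi>\<close> in the second coordinate. They are nonnegative,
  and the Fourier transforms of the weighted first marginals are combinations of the integrals of
  \<open>exp (\<i> (u x + \<phi> y))\<close>. Hence the integral of \<open>exp (\<i> \<phi>)\<close> over the strip \<open>{x \<in> B}\<close> is determined for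
  each Borel set \<open>B\<close>, so the law of \<open>y\<close> on that strip is determined, and with it every rectangle.
\<close>

lemma determining_pair:
  assumes det: "determining S \<Phi>"
  shows "determining (borel \<Otimes>\<^sub>M S) {\<lambda>z. u * fst z + \<phi> (snd z) | u \<phi>. \<phi> \<in> \<Phi>}"
  unfolding determining_def
proof (intro conjI allI impI)
  have meas: "\<phi> \<in> borel_measurable S" if "\<phi> \<in> \<Phi>" for \<phi>
    using det that by (auto simp: determining_def)
  have zero: "(\<lambda>_. 0) \<in> \<Phi>" using det by (auto simp: determining_def)
  show "{\<lambda>z. u * fst z + \<phi> (snd z) | u \<phi>. \<phi> \<in> \<Phi>} \<subseteq> borel_measurable (borel \<Otimes>\<^sub>M S)"
    using meas by auto
  show "(\<lambda>_. 0) \<in> {\<lambda>z. u * fst z + \<phi> (snd z) | u \<phi>. \<phi> \<in> \<Phi>}"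
    using zero by (intro CollectI exI[of _ 0] exI[of _ "\<lambda>_. 0"]) auto
  fix \<mu> \<nu> :: "(real \<times> 'a) measure"
  assume H: "finite_measure \<mu> \<and> finite_measure \<nu> \<and> sets \<mu> = sets (borel \<Otimes>\<^sub>M S) \<and>
    sets \<nu> = sets (borel \<Otimes>\<^sub>M S) \<and>
    (\<forall>\<phi>\<in>{\<lambda>z. u * fst z + \<phi> (snd z) | u \<phi>. \<phi> \<in> \<Phi>}. (\<integral>x. iexp (\<phi> x) \<partial>\<mu>) = (\<integral>x. iexp (\<phi> x) \<partial>\<nu>))"
  then have fin: "finite_measure \<mu>" "finite_measure \<nu>"
    and sets[measurable_cong]: "sets \<mu> = sets (borel \<Otimes>\<^sub>M S)" "sets \<nu> = sets (borel \<Otimes>\<^sub>M S)"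
    by auto
  have E: "(\<integral>z. iexp (u * fst z + \<phi> (snd z)) \<partial>\<mu>) = (\<integral>z. iexp (u * fst z + \<phi> (snd z)) \<partial>\<nu>)"
    if "\<phi> \<in> \<Phi>" for u \<phi>
  proof -
    have "\<forall>\<phi>\<in>{\<lambda>z. u * fst z + \<phi> (snd z) | u \<phi>. \<phi> \<in> \<Phi>}. (\<integral>x. iexp (\<phi> x) \<partial>\<mu>) = (\<integral>x. iexp (\<phi> x) \<partial>\<nu>)"
      using H by simp
    then show ?thesis by (rule bspec) (use that in blast)
  qed
  interpret \<mu>: finite_measure \<mu> by fact
  interpret \<nu>: finite_measure \<nu> by fact
  have int: "integrable \<rho> (\<lambda>z. iexp (f z))"
    if "f \<in> borel_measurable \<rho>" "finite_measure \<rho>" for f and \<rho> :: "(real \<times> 'a) measure"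
    using that by (intro finite_measure.integrable_const_bound[of _ _ 1]) auto
  have intm: "integrable \<rho> f"
    if "f \<in> borel_measurable \<rho>" "finite_measure \<rho>" "\<And>z. \<bar>f z\<bar> \<le> 2" for f :: "real \<times> 'a \<Rightarrow> real" and \<rho>
    using that by (intro finite_measure.integrable_const_bound[of _ _ 2]) auto
  have trig: "(\<integral>z. (1 + cos (\<phi> (snd z))) *\<^sub>R iexp (u * fst z) \<partial>\<rho>)
        = (\<integral>z. iexp (u * fst z + 0) \<partial>\<rho>)
          + ((\<integral>z. iexp (u * fst z + \<phi> (snd z)) \<partial>\<rho>) + cnj (\<integral>z. iexp ((-u) * fst z + \<phi> (snd z)) \<partial>\<rho>)) / 2"
      "(\<integral>z. (1 + sin (\<phi> (snd z))) *\<^sub>R iexp (u * fst z) \<partial>\<rho>)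
        = (\<integral>z. iexp (u * fst z + 0) \<partial>\<rho>)
          + ((\<integral>z. iexp (u * fst z + \<phi> (snd z)) \<partial>\<rho>)
            - cnj (\<integral>z. iexp ((-u) * fst z + \<phi> (snd z)) \<partial>\<rho>)) / (2 * \<i>)"
    if \<phi>: "\<phi> \<in> \<Phi>" and fin: "finite_measure \<rho>" and [measurable_cong]: "sets \<rho> = sets (borel \<Otimes>\<^sub>M S)"
    for \<phi> u \<rho>
  proof -
    note [measurable] = meas[OF \<phi>]
    have i: "integrable \<rho> (\<lambda>z. iexp (u * fst z + 0))" "integrable \<rho> (\<lambda>z. iexp (u * fst z + \<phi> (snd z)))"
      "integrable \<rho> (\<lambda>z. cnj (iexp ((-u) * fst z + \<phi> (snd z))))"
      by (intro int[THEN integrable_cnj] int fin; measurable)+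
    have "(\<integral>z. (1 + cos (\<phi> (snd z))) *\<^sub>R iexp (u * fst z) \<partial>\<rho>) =
       (\<integral>z. iexp (u * fst z + 0) + (iexp (u * fst z + \<phi> (snd z))
         + cnj (iexp ((-u) * fst z + \<phi> (snd z)))) / 2 \<partial>\<rho>)"
      by (intro Bochner_Integration.integral_cong refl)
         (auto simp: complex_eq_iff Re_exp Im_exp cos_add sin_add cos_diff sin_diff algebra_simps)
    also have "\<dots> = (\<integral>z. iexp (u * fst z + 0) \<partial>\<rho>)
          + ((\<integral>z. iexp (u * fst z + \<phi> (snd z)) \<partial>\<rho>)
            + (\<integral>z. cnj (iexp ((-u) * fst z + \<phi> (snd z))) \<partial>\<rho>)) / 2"
      using i by simp
    finally show "(\<integral>z. (1 + cos (\<phi> (snd z))) *\<^sub>R iexp (u * fst z) \<partial>\<rho>)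
        = (\<integral>z. iexp (u * fst z + 0) \<partial>\<rho>)
          + ((\<integral>z. iexp (u * fst z + \<phi> (snd z)) \<partial>\<rho>) + cnj (\<integral>z. iexp ((-u) * fst z + \<phi> (snd z)) \<partial>\<rho>)) / 2"
      by (simp only: Bochner_Integration.integral_cnj)
    have "(\<integral>z. (1 + sin (\<phi> (snd z))) *\<^sub>R iexp (u * fst z) \<partial>\<rho>) =
       (\<integral>z. iexp (u * fst z + 0) + (iexp (u * fst z + \<phi> (snd z))
         - cnj (iexp ((-u) * fst z + \<phi> (snd z)))) / (2 * \<i>) \<partial>\<rho>)"
      by (intro Bochner_Integration.integral_cong refl)
         (auto simp: complex_eq_iff Re_exp Im_exp cos_add sin_add cos_diff sin_diff algebra_simps
           Re_divide Im_divide power2_eq_square)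
    also have "\<dots> = (\<integral>z. iexp (u * fst z + 0) \<partial>\<rho>)
          + ((\<integral>z. iexp (u * fst z + \<phi> (snd z)) \<partial>\<rho>)
            - (\<integral>z. cnj (iexp ((-u) * fst z + \<phi> (snd z))) \<partial>\<rho>)) / (2 * \<i>)"
      using i by simp
    finally show "(\<integral>z. (1 + sin (\<phi> (snd z))) *\<^sub>R iexp (u * fst z) \<partial>\<rho>)
        = (\<integral>z. iexp (u * fst z + 0) \<partial>\<rho>)
          + ((\<integral>z. iexp (u * fst z + \<phi> (snd z)) \<partial>\<rho>)
            - cnj (\<integral>z. iexp ((-u) * fst z + \<phi> (snd z)) \<partial>\<rho>)) / (2 * \<i>)"
      by (simp only: Bochner_Integration.integral_cnj)
  qed
  have slice: "(\<integral>z. indicator B (fst z) *\<^sub>R iexp (\<phi> (snd z)) \<partial>\<mu>)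
    = (\<integral>z. indicator B (fst z) *\<^sub>R iexp (\<phi> (snd z)) \<partial>\<nu>)"
    if \<phi>: "\<phi> \<in> \<Phi>" and B[measurable]: "B \<in> sets borel" for \<phi> B
  proof -
    note [measurable] = meas[OF \<phi>]
    note w = weighted_first_marginal_eq[OF fin sets _ _ _ _ B]
    \<comment> \<open>\<open>E\<close> at the zero phase serves the constant part of each weight.\<close>
    have c: "(\<integral>z. (1 + cos (\<phi> (snd z))) * indicator B (fst z) \<partial>\<mu>)
      = (\<integral>z. (1 + cos (\<phi> (snd z))) * indicator B (fst z) \<partial>\<nu>)"
      apply (rule w)
         apply measurable
      subgoal for z using cos_ge_minus_one[of "\<phi> (snd z)"] by linarith
      subgoal for z using cos_le_one[of "\<phi> (snd z)"] by linarith
      subgoal by (simp only: trig[OF \<phi> fin(1) sets(1)] trig[OF \<phi> fin(2) sets(2)] E[OF \<phi>] E[OF zero])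
      done
    have s: "(\<integral>z. (1 + sin (\<phi> (snd z))) * indicator B (fst z) \<partial>\<mu>)
      = (\<integral>z. (1 + sin (\<phi> (snd z))) * indicator B (fst z) \<partial>\<nu>)"
      apply (rule w)
         apply measurable
      subgoal for z using sin_ge_minus_one[of "\<phi> (snd z)"] by linarith
      subgoal for z using sin_le_one[of "\<phi> (snd z)"] by linarith
      subgoal by (simp only: trig[OF \<phi> fin(1) sets(1)] trig[OF \<phi> fin(2) sets(2)] E[OF \<phi>] E[OF zero])
      done
    have o: "(\<integral>z. 1 * indicator B (fst z) \<partial>\<mu>) = (\<integral>z. 1 * indicator B (fst z) \<partial>\<nu> :: real)"
      using E[OF zero] by (intro w) auto
    have "(\<integral>z. indicator B (fst z) *\<^sub>R iexp (\<phi> (snd z)) \<partial>\<rho>) =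
       of_real ((\<integral>z. (1 + cos (\<phi> (snd z))) * indicator B (fst z) \<partial>\<rho>) - (\<integral>z. 1 * indicator B (fst z) \<partial>\<rho>))
       + \<i> * of_real ((\<integral>z. (1 + sin (\<phi> (snd z))) * indicator B (fst z) \<partial>\<rho>)
         - (\<integral>z. 1 * indicator B (fst z) \<partial>\<rho>))"
      if fin: "finite_measure \<rho>" and [measurable_cong]: "sets \<rho> = sets (borel \<Otimes>\<^sub>M S)"
        for \<rho> :: "(real \<times> 'a) measure"
    proof -
      have i: "integrable \<rho> (\<lambda>z. cos (\<phi> (snd z)) * indicator B (fst z))"
        "integrable \<rho> (\<lambda>z. sin (\<phi> (snd z)) * indicator B (fst z))"
        "integrable \<rho> (\<lambda>z. 1 * indicator B (fst z) :: real)"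
        by (intro intm fin; measurable?; auto
          simp: indicator_def intro: order_trans[OF abs_cos_le_one] order_trans[OF abs_sin_le_one])+
      have "(\<integral>z. indicator B (fst z) *\<^sub>R iexp (\<phi> (snd z)) \<partial>\<rho>) =
        (\<integral>z. of_real (cos (\<phi> (snd z)) * indicator B (fst z)) + \<i>
          * of_real (sin (\<phi> (snd z)) * indicator B (fst z)) \<partial>\<rho>)"
        by (intro Bochner_Integration.integral_cong refl) (auto simp: complex_eq_iff Re_exp Im_exp)
      also have "\<dots> = of_real (\<integral>z. cos (\<phi> (snd z)) * indicator B (fst z) \<partial>\<rho>)
          + \<i> * of_real (\<integral>z. sin (\<phi> (snd z)) * indicator B (fst z) \<partial>\<rho>)"
        using i(1,2)[THEN integrable_of_real[where 'a=complex]]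
        by (subst Bochner_Integration.integral_add) (auto simp del: of_real_mult)
      finally show ?thesis using i by (simp add: distrib_right del: of_real_mult)
    qed
    then show ?thesis using c s o fin sets by simp
  qed
  have rect: "emeasure \<mu> (B \<times> C) = emeasure \<nu> (B \<times> C)" if [measurable]: "B \<in> sets borel"
    "C \<in> sets S" for B C
  proof -
    define h where "h = (\<lambda>z::real \<times> 'a. indicator B (fst z) :: real)"
    have h[measurable]: "h \<in> borel_measurable (borel \<Otimes>\<^sub>M S)" unfolding h_def by measurable
    have fin': "finite_measure (distr (density \<rho> h) S snd)"
      if "finite_measure \<rho>" and [measurable_cong]: "sets \<rho> = sets (borel \<Otimes>\<^sub>M S)" for \<rho>
    proof -
      interpret finite_measure \<rho> by fact
      have "(\<integral>\<^sup>+z. ennreal (h z) \<partial>\<rho>) \<le> (\<integral>\<^sup>+z. 1 \<partial>\<rho>)"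
        by (intro nn_integral_mono) (simp add: h_def indicator_def)
      also have "\<dots> < \<infinity>" by (simp add: emeasure_eq_measure)
      finally have "(\<integral>\<^sup>+z. ennreal (h z) \<partial>\<rho>) < \<infinity>" .
      then have "emeasure (density \<rho> h) (space \<rho>) \<noteq> \<infinity>"
        by (subst emeasure_density) (auto cong: nn_integral_cong)
      then have "finite_measure (density \<rho> h)" by (intro finite_measureI) simp
      then show ?thesis by (rule finite_measure.finite_measure_distr) measurable
    qed
    have "distr (density \<mu> h) S snd = distr (density \<nu> h) S snd"
    proof (rule determiningD[OF det])
      fix \<phi> assume \<phi>: "\<phi> \<in> \<Phi>"
      note [measurable] = meas[OF \<phi>]
      have "(\<integral>y. iexp (\<phi> y) \<partial>distr (density \<rho> h) S snd)
        = (\<integral>z. indicator B (fst z) *\<^sub>R iexp (\<phi> (snd z)) \<partial>\<rho>)"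
        if [measurable_cong]: "sets \<rho> = sets (borel \<Otimes>\<^sub>M S)" for \<rho> :: "(real \<times> 'a) measure"
        by (subst integral_distr, measurable) (subst integral_density, auto simp: h_def)
      then show "(\<integral>y. iexp (\<phi> y) \<partial>distr (density \<mu> h) S snd)
        = (\<integral>y. iexp (\<phi> y) \<partial>distr (density \<nu> h) S snd)"
        using slice[OF \<phi>] sets by simp
    qed (simp_all add: fin' fin sets)
    then have "emeasure (distr (density \<mu> h) S snd) C = emeasure (distr (density \<nu> h) S snd) C" by simp
    moreover have "emeasure (distr (density \<rho> h) S snd) C = emeasure \<rho> (B \<times> C)"
      if s[measurable_cong]: "sets \<rho> = sets (borel \<Otimes>\<^sub>M S)" for \<rho> :: "(real \<times> 'a) measure"
    proof -
      have sp: "space \<rho> = UNIV \<times> space S" using sets_eq_imp_space_eq[OF s]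
        by (simp add: space_pair_measure)
      have "emeasure (distr (density \<rho> h) S snd) C
        = (\<integral>\<^sup>+z. ennreal (h z) * indicator (snd -` C \<inter> space \<rho>) z \<partial>\<rho>)"
        by (subst emeasure_distr, measurable) (simp, subst emeasure_density, auto)
      also have "\<dots> = (\<integral>\<^sup>+z. indicator (B \<times> C) z \<partial>\<rho>)"
        using sp by (intro nn_integral_cong) (auto simp: h_def indicator_def)
      finally show ?thesis by simp
    qed
    ultimately show ?thesis using sets by simp
  qed
  show "\<mu> = \<nu>"
  proof (rule measure_eqI_generator_eq[OF Int_stable_pair_measure_generator[of borel S],
    where A="\<lambda>_. UNIV \<times> space S"])
    show "{a \<times> b |a b. a \<in> sets borel \<and> b \<in> sets S} \<subseteq> Pow (UNIV \<times> space S)"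
      using sets.sets_into_space by auto
    show "sets \<mu> = sigma_sets (UNIV \<times> space S) {a \<times> b |a b. a \<in> sets borel \<and> b \<in> sets S}"
      "sets \<nu> = sigma_sets (UNIV \<times> space S) {a \<times> b |a b. a \<in> sets borel \<and> b \<in> sets S}"
      by (simp_all add: sets sets_pair_measure)
    show "range (\<lambda>_::nat. UNIV \<times> space S) \<subseteq> {a \<times> b |a b. a \<in> sets borel \<and> b \<in> sets S}"
      using sets.top[of S] by (auto intro!: exI[of _ UNIV] exI[of _ "space S"])
    show "emeasure \<mu> (UNIV \<times> space S) \<noteq> \<infinity>" by simp
  qed (auto simp: rect)
qed


lemma determining_transfer:
  assumes det: "determining S \<Phi>"
    and f[measurable]: "f \<in> S' \<rightarrow>\<^sub>M S" and g[measurable]: "g \<in> S \<rightarrow>\<^sub>M S'"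
    and gf: "\<And>x. x \<in> space S' \<Longrightarrow> g (f x) = x"
    and sub: "\<Phi>' \<subseteq> borel_measurable S'" "(\<lambda>_. 0) \<in> \<Phi>'"
    and \<Phi>': "\<And>\<phi>. \<phi> \<in> \<Phi> \<Longrightarrow> \<exists>\<psi>\<in>\<Phi>'. \<forall>x\<in>space S'. \<psi> x = \<phi> (f x)"
  shows "determining S' \<Phi>'"
  unfolding determining_def
proof (intro conjI allI impI sub)
  fix \<mu> \<nu> :: "'b measure"
  assume "finite_measure \<mu> \<and> finite_measure \<nu> \<and> sets \<mu> = sets S' \<and> sets \<nu> = sets S' \<and>
    (\<forall>\<phi>\<in>\<Phi>'. (\<integral>x. iexp (\<phi> x) \<partial>\<mu>) = (\<integral>x. iexp (\<phi> x) \<partial>\<nu>))"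
  then have fin: "finite_measure \<mu>" "finite_measure \<nu>"
    and sets[measurable_cong]: "sets \<mu> = sets S'" "sets \<nu> = sets S'"
    and E: "\<And>\<phi>. \<phi> \<in> \<Phi>' \<Longrightarrow> (\<integral>x. iexp (\<phi> x) \<partial>\<mu>) = (\<integral>x. iexp (\<phi> x) \<partial>\<nu>)"
    by auto
  have sp: "space \<mu> = space S'" "space \<nu> = space S'"
    using sets[THEN sets_eq_imp_space_eq] by auto
  have "distr \<mu> S f = distr \<nu> S f"
  proof (rule determiningD[OF det])
    fix \<phi> assume \<phi>: "\<phi> \<in> \<Phi>"
    then have [measurable]: "\<phi> \<in> borel_measurable S" using det by (auto simp: determining_def)
    obtain \<psi> where \<psi>: "\<psi> \<in> \<Phi>'" "\<And>x. x \<in> space S' \<Longrightarrow> \<psi> x = \<phi> (f x)" using \<Phi>'[OF \<phi>] by blast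
    have "(\<integral>x. iexp (\<phi> x) \<partial>distr \<mu> S f) = (\<integral>x. iexp (\<psi> x) \<partial>\<mu>)"
      by (subst integral_distr, measurable) (intro Bochner_Integration.integral_cong, auto simp: \<psi> sp)
    moreover have "(\<integral>x. iexp (\<phi> x) \<partial>distr \<nu> S f) = (\<integral>x. iexp (\<psi> x) \<partial>\<nu>)"
      by (subst integral_distr, measurable) (intro Bochner_Integration.integral_cong, auto simp: \<psi> sp)
    ultimately show "(\<integral>x. iexp (\<phi> x) \<partial>distr \<mu> S f) = (\<integral>x. iexp (\<phi> x) \<partial>distr \<nu> S f)"
      using E[OF \<psi>(1)] by simp
  qed (auto intro!: finite_measure.finite_measure_distr fin)
  then have "distr (distr \<mu> S f) S' g = distr (distr \<nu> S f) S' g" by simp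
  moreover have "distr (distr \<rho> S f) S' g = \<rho>" if [measurable_cong]: "sets \<rho> = sets S'" for \<rho>
  proof -
    have "distr (distr \<rho> S f) S' g = distr \<rho> S' (g \<circ> f)"
      by (rule distr_distr) measurable
    also have "\<dots> = distr \<rho> \<rho> (\<lambda>x. x)"
      using that sets_eq_imp_space_eq[OF that] gf by (intro distr_cong) auto
    finally show ?thesis by simp
  qed
  ultimately show "\<mu> = \<nu>" using sets by simp
qed

text \<open>
  The theorem of Cramer and Wold: the laws of all linear combinations of the coordinates determine
  a finite measure on a finite-dimensional space.
\<close>

lemma determining_PiM:
  fixes J :: "'i set"
  assumes "finite J"
  shows "determining (\<Pi>\<^sub>M j\<in>J. (borel :: real measure)) {\<lambda>x. \<Sum>j\<in>J. v j * x j | v. True}"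
  using assms
proof (induction J rule: finite_induct)
  case empty
  have "\<mu> = \<nu>"
    if fin: "finite_measure \<mu>" "finite_measure \<nu>"
      and sets: "sets \<mu> = sets (\<Pi>\<^sub>M j\<in>{}. (borel :: real measure))" "sets \<nu>
        = sets (\<Pi>\<^sub>M j\<in>{}. (borel :: real measure))"
      and E: "(\<integral>x. iexp 0 \<partial>\<mu>) = (\<integral>x. iexp 0 \<partial>\<nu>)" for \<mu> \<nu> :: "('i \<Rightarrow> real) measure"
  proof (rule measure_eqI)
    interpret \<mu>: finite_measure \<mu> by fact
    interpret \<nu>: finite_measure \<nu> by fact
    have "measure \<mu> (space \<mu>) = measure \<nu> (space \<nu>)" using E by simp
    then have "emeasure \<mu> (space \<mu>) = emeasure \<nu> (space \<mu>)"
      using sets_eq_imp_space_eq[of \<mu> \<nu>] sets by (simp add: \<mu>.emeasure_eq_measure \<nu>.emeasure_eq_measure)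
    moreover have "space \<mu> = {\<lambda>k. undefined}"
      using sets_eq_imp_space_eq[OF sets(1)] by (simp add: space_PiM_empty)
    moreover fix A assume "A \<in> sets \<mu>"
    ultimately show "emeasure \<mu> A = emeasure \<nu> A" using sets by (auto simp: sets_PiM_empty)
  qed (simp add: sets)
  then show ?case by (auto simp: determining_def)
next
  case (insert i I)
  let ?S = "borel \<Otimes>\<^sub>M (\<Pi>\<^sub>M j\<in>I. (borel :: real measure))"
  show ?case
  proof (rule determining_transfer[OF determining_pair[OF insert.IH]])
    show "(\<lambda>x. (x i, restrict x I)) \<in> (\<Pi>\<^sub>M j\<in>insert i I. borel) \<rightarrow>\<^sub>M ?S"
      by (intro measurable_Pair measurable_component_singleton measurable_restrict_subset) auto
    show "(\<lambda>(a, y). y(i := a)) \<in> ?S \<rightarrow>\<^sub>M (\<Pi>\<^sub>M j\<in>insert i I. borel)"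
      unfolding split_beta
      by (rule measurable_fun_upd[where J=I]) measurable
    show "(case (x i, restrict x I) of (a, y) \<Rightarrow> y(i := a)) = x"
      if "x \<in> space (\<Pi>\<^sub>M j\<in>insert i I. (borel :: real measure))" for x
      using that insert.hyps by (auto simp: space_PiM PiE_def extensional_def fun_eq_iff)
    show "{\<lambda>x. \<Sum>j\<in>insert i I. v j * x j |v. True}
      \<subseteq> borel_measurable (\<Pi>\<^sub>M j\<in>insert i I. (borel :: real measure))"
      by (auto simp del: sum.insert
        intro!: borel_measurable_sum borel_measurable_times measurable_component_singleton)
    show "(\<lambda>_. 0) \<in> {\<lambda>x::_ \<Rightarrow> real. \<Sum>j\<in>insert i I. v j * x j |v. True}"
      by (intro CollectI exI[of _ "\<lambda>_. 0"]) auto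
    fix \<phi> :: "real \<times> (_ \<Rightarrow> real) \<Rightarrow> real" assume
      "\<phi> \<in> {\<lambda>z. u * fst z + \<phi> (snd z) |u \<phi>. \<phi> \<in> {\<lambda>x. \<Sum>j\<in>I. v j * x j |v. True}}"
    then obtain u v where \<phi>: "\<phi> = (\<lambda>z. u * fst z + (\<Sum>j\<in>I. v j * snd z j))" by auto
    show "\<exists>\<psi>\<in>{\<lambda>x. \<Sum>j\<in>insert i I. v j * x j |v. True}.
        \<forall>x\<in>space (\<Pi>\<^sub>M j\<in>insert i I. (borel :: real measure)). \<psi> x = \<phi> (x i, restrict x I)"
    proof (intro bexI ballI)
      show "(\<Sum>j\<in>insert i I. (v(i := u)) j * x j) = \<phi> (x i, restrict x I)" for x
        using insert.hyps by (auto simp: \<phi> intro!: sum.cong)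
    qed blast
  qed
qed

text \<open>
  If the joint characteristic function of \<open>W\<close> and the vector \<open>Z\<close> factorises, their joint law is the
  product law. The conclusion is stated for real functions \<open>k\<close> of the vector because
  \<open>indep_var\<close> relates variables with values in one type.
\<close>

lemma (in prob_space) indep_var_of_char:
  assumes W[measurable]: "random_variable borel W"
    and Z[measurable]: "\<And>j. j \<in> J \<Longrightarrow> random_variable borel (Z j)"
    and J: "finite J"
    and char: "\<And>u v. expectation (\<lambda>\<omega>. iexp (u * W \<omega> + (\<Sum>j\<in>J. v j * Z j \<omega>)))
      = expectation (\<lambda>\<omega>. iexp (u * W \<omega>)) * expectation (\<lambda>\<omega>. iexp (\<Sum>j\<in>J. v j * Z j \<omega>))"
    and k: "k \<in> borel_measurable (\<Pi>\<^sub>M j\<in>J. (borel :: real measure))"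
  shows "indep_var borel W borel (\<lambda>\<omega>. k (\<lambda>j\<in>J. Z j \<omega>) :: real)"
proof -
  define S where "S = (\<Pi>\<^sub>M j\<in>J. (borel :: real measure))"
  define V where "V = (\<lambda>\<omega>. \<lambda>j\<in>J. Z j \<omega>)"
  have V[measurable]: "random_variable S V" unfolding V_def S_def by measurable
  interpret DW: prob_space "distr M borel W" by (rule prob_space_distr) measurable
  interpret DV: prob_space "distr M S V" by (rule prob_space_distr) measurable
  interpret P: pair_prob_space "distr M borel W" "distr M S V" ..
  have joint: "distr M borel W \<Otimes>\<^sub>M distr M S V = distr M (borel \<Otimes>\<^sub>M S) (\<lambda>x. (W x, V x))"
  proof (rule determiningD[OF determining_pair[OF determining_PiM[OF J], folded S_def]])
    show "finite_measure (distr M borel W \<Otimes>\<^sub>M distr M S V)" by (rule P.finite_measure_axioms)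
    show "finite_measure (distr M (borel \<Otimes>\<^sub>M S) (\<lambda>x. (W x, V x)))"
      by (rule finite_measure_distr) measurable
    show "sets (distr M borel W \<Otimes>\<^sub>M distr M S V) = sets (borel \<Otimes>\<^sub>M S)"
      by (intro sets_pair_measure_cong) auto
    fix \<phi> :: "real \<times> (_ \<Rightarrow> real) \<Rightarrow> real" assume
      "\<phi> \<in> {\<lambda>z. u * fst z + \<phi> (snd z) |u \<phi>. \<phi> \<in> {\<lambda>x. \<Sum>j\<in>J. v j * x j |v. True}}"
    then obtain u v where \<phi>: "\<phi> = (\<lambda>z. u * fst z + (\<Sum>j\<in>J. v j * snd z j))" by auto
    have [measurable]: "(\<lambda>x. \<Sum>j\<in>J. v j * x j) \<in> borel_measurable S"
      unfolding S_def by measurable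
    have \<phi>m[measurable]: "\<phi> \<in> borel_measurable (borel \<Otimes>\<^sub>M S)"
      unfolding \<phi> by measurable
    have [simp]: "(\<Sum>j\<in>J. v j * V \<omega> j) = (\<Sum>j\<in>J. v j * Z j \<omega>)" for \<omega>
      by (intro sum.cong) (auto simp: V_def)
    have "(\<integral>z. iexp (\<phi> z) \<partial>(distr M borel W \<Otimes>\<^sub>M distr M S V))
       = (\<integral>a. (\<integral>y. iexp (\<phi> (a, y)) \<partial>distr M S V) \<partial>distr M borel W)"
      by (rule P.integral_fst'[symmetric]) (intro P.integrable_const_bound[of _ 1]; simp)
    also have "\<dots> = (\<integral>a. (\<integral>y. iexp (u * a) * iexp (\<Sum>j\<in>J. v j * y j) \<partial>distr M S V) \<partial>distr M borel W)"
      by (simp add: \<phi> exp_add[symmetric] distrib_left)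
    also have "\<dots> = (\<integral>a. iexp (u * a) \<partial>distr M borel W) * (\<integral>y. iexp (\<Sum>j\<in>J. v j * y j) \<partial>distr M S V)"
      by (simp only: integral_mult_right_zero integral_mult_left_zero)
    also have "\<dots> = expectation (\<lambda>\<omega>. iexp (u * W \<omega>)) * expectation (\<lambda>\<omega>. iexp (\<Sum>j\<in>J. v j * Z j \<omega>))"
      by (simp add: integral_distr del: of_real_sum of_real_mult)
    also have "\<dots> = (\<integral>z. iexp (\<phi> z) \<partial>distr M (borel \<Otimes>\<^sub>M S) (\<lambda>x. (W x, V x)))"
      by (subst integral_distr) (simp_all add: char[symmetric] \<phi> del: of_real_sum of_real_mult
        of_real_add)
    finally show "(\<integral>z. iexp (\<phi> z) \<partial>(distr M borel W \<Otimes>\<^sub>M distr M S V))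
      = (\<integral>z. iexp (\<phi> z) \<partial>distr M (borel \<Otimes>\<^sub>M S) (\<lambda>x. (W x, V x)))" .
  qed simp
  have km[measurable]: "k \<in> borel_measurable S" using k by (simp add: S_def)
  have "distr M borel W \<Otimes>\<^sub>M distr M borel (\<lambda>\<omega>. k (V \<omega>))
      = distr (distr M borel W) borel (\<lambda>x. x) \<Otimes>\<^sub>M distr (distr M S V) borel k"
    by (simp add: distr_distr comp_def)
  also have "\<dots> = distr (distr M borel W \<Otimes>\<^sub>M distr M S V) (borel \<Otimes>\<^sub>M borel) (\<lambda>(x, y). (x, k y))"
    by (intro pair_measure_distr prob_space_imp_sigma_finite) (auto
      intro!: prob_space_distr prob_space.prob_space_distr simp: DV.prob_space_axioms)
  also have "\<dots> = distr M (borel \<Otimes>\<^sub>M borel) (\<lambda>\<omega>. (W \<omega>, k (V \<omega>)))"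
    unfolding joint by (subst distr_distr) (auto simp: comp_def)
  finally have "indep_var borel W borel (\<lambda>\<omega>. k (V \<omega>))"
    unfolding indep_var_distribution_eq by simp
  then show ?thesis unfolding V_def .
qed

section \<open>Wiener integrals and their kernels\<close>

lemma (in prob_space) char_centered_normal:
  assumes "\<sigma> > 0" and D: "distributed M lborel X (normal_density 0 \<sigma>)"
  shows "expectation (\<lambda>\<omega>. iexp (u * X \<omega>)) = exp (- (u\<^sup>2 * \<sigma>\<^sup>2) / 2)"
proof -
  have X[measurable]: "X \<in> borel_measurable M"
    using D by (auto simp: distributed_def)
  have "distributed M lborel (\<lambda>x. X x / \<sigma>) std_normal_density"
    using normal_standard_normal_convert[OF assms(1), of X 0] D by simp
  then have std: "distr M lborel (\<lambda>x. X x / \<sigma>) = std_normal_distribution"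
    by (simp add: distributed_def)
  have "expectation (\<lambda>\<omega>. iexp (u * X \<omega>)) = expectation (\<lambda>\<omega>. iexp ((u * \<sigma>) * (X \<omega> / \<sigma>)))"
    using assms(1) by simp
  also have "\<dots> = char (distr M lborel (\<lambda>x. X x / \<sigma>)) (u * \<sigma>)"
    unfolding char_def by (subst integral_distr) auto
  also have "\<dots> = exp (- ((u * \<sigma>)\<^sup>2) / 2)"
    unfolding std char_std_normal_distribution ..
  finally show ?thesis by (simp add: power_mult_distrib)
qed

lemma grid_exists:
  fixes P :: "real set"
  assumes "finite P" "P \<subseteq> {0..}"
  obtains n s where "strict_mono_on {..n::nat} s" "s 0 = 0" "P \<subseteq> s ` {..n}"
proof -
  define L where "L = sorted_list_of_set (insert 0 P)"
  have set: "set L = insert 0 P" and srt: "sorted_wrt (<) L"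
    unfolding L_def using assms by (simp only: set_sorted_list_of_set finite_insert)
      (rule strict_sorted_list_of_set)
  define n where "n = length L - 1"
  have len: "length L = Suc n" using set by (cases L) (auto simp: n_def)
  have "strict_mono_on {..n} (\<lambda>i. L ! i)"
    using srt len by (auto simp: strict_mono_on_def sorted_wrt_iff_nth_less)
  moreover have "L ! 0 = 0"
  proof -
    obtain k where k: "k < length L" "L ! k = 0" using set by (metis in_set_conv_nth insertI1)
    have "L ! 0 \<ge> 0" using set assms len nth_mem[of 0 L] by auto
    then show ?thesis using k sorted_wrt_nth_less[OF srt, of 0 k] by (cases "k = 0") auto
  qed
  moreover have "P \<subseteq> (\<lambda>i. L ! i) ` {..n}"
    using set len by (auto simp: set_conv_nth less_Suc_eq_le)
  ultimately show ?thesis by (rule that)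
qed

lemma nn_square_add_tendsto:
  fixes N :: "'c measure" and f g :: "nat \<Rightarrow> 'c \<Rightarrow> real"
  assumes [measurable]: "\<And>k. f k \<in> borel_measurable N" "\<And>k. g k \<in> borel_measurable N"
    and f: "(\<lambda>k. \<integral>\<^sup>+x. ennreal ((f k x)\<^sup>2) \<partial>N) \<longlonglongrightarrow> 0" and g: "(\<lambda>k. \<integral>\<^sup>+x. ennreal ((g k x)\<^sup>2) \<partial>N) \<longlonglongrightarrow> 0"
  shows "(\<lambda>k. \<integral>\<^sup>+x. ennreal ((f k x + g k x)\<^sup>2) \<partial>N) \<longlonglongrightarrow> 0"
proof (rule tendsto_sandwich[OF _ _ tendsto_const])
  have "(\<lambda>k. 2 * (\<integral>\<^sup>+x. ennreal ((f k x)\<^sup>2) \<partial>N) + 2 * (\<integral>\<^sup>+x. ennreal ((g k x)\<^sup>2) \<partial>N)) \<longlonglongrightarrow> 2 * 0 + 2 * 0"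
    by (intro tendsto_add ennreal_tendsto_cmult f g) auto
  then show "(\<lambda>k. 2 * (\<integral>\<^sup>+x. ennreal ((f k x)\<^sup>2) \<partial>N) + 2 * (\<integral>\<^sup>+x. ennreal ((g k x)\<^sup>2) \<partial>N)) \<longlonglongrightarrow> 0"
    by simp
  have "(\<integral>\<^sup>+x. ennreal ((f k x + g k x)\<^sup>2) \<partial>N)
    \<le> 2 * (\<integral>\<^sup>+x. ennreal ((f k x)\<^sup>2) \<partial>N) + 2 * (\<integral>\<^sup>+x. ennreal ((g k x)\<^sup>2) \<partial>N)" for k
  proof -
    have "(\<integral>\<^sup>+x. ennreal ((f k x + g k x)\<^sup>2) \<partial>N)
      \<le> (\<integral>\<^sup>+x. 2 * ennreal ((f k x)\<^sup>2) + 2 * ennreal ((g k x)\<^sup>2) \<partial>N)"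
    proof (intro nn_integral_mono)
      fix x
      have "(f k x + g k x)\<^sup>2 \<le> 2 * (f k x)\<^sup>2 + 2 * (g k x)\<^sup>2"
        using sum_squares_bound[of "f k x" "g k x"] by (simp add: power2_sum)
      then have "ennreal ((f k x + g k x)\<^sup>2) \<le> ennreal (2 * (f k x)\<^sup>2 + 2 * (g k x)\<^sup>2)"
        by (rule ennreal_leI)
      then show "ennreal ((f k x + g k x)\<^sup>2) \<le> 2 * ennreal ((f k x)\<^sup>2) + 2 * ennreal ((g k x)\<^sup>2)"
        by (simp add: ennreal_mult)
    qed
    also have "\<dots> = 2 * (\<integral>\<^sup>+x. ennreal ((f k x)\<^sup>2) \<partial>N) + 2 * (\<integral>\<^sup>+x. ennreal ((g k x)\<^sup>2) \<partial>N)"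
      by (simp add: nn_integral_add nn_integral_cmult)
    finally show ?thesis .
  qed
  then show "\<forall>\<^sub>F k in sequentially. (\<integral>\<^sup>+x. ennreal ((f k x + g k x)\<^sup>2) \<partial>N)
    \<le> 2 * (\<integral>\<^sup>+x. ennreal ((f k x)\<^sup>2) \<partial>N) + 2 * (\<integral>\<^sup>+x. ennreal ((g k x)\<^sup>2) \<partial>N)"
    by simp
qed simp

context prob_space
begin

lemma step_fun_square_has_integral:
  assumes s: "strict_mono_on {..n} s"
  shows "square_integrable lborel (step_fun n s c)"
    and "(\<integral>x. (step_fun n s c x)\<^sup>2 \<partial>lborel) = (\<Sum>i<n. (c i)\<^sup>2 * (s (Suc i) - s i))"
proof -
  have le: "s i \<le> s j" if "i \<le> j" "j \<le> n" for i j
    using s that by (cases "i = j") (auto dest: strict_mono_onD[of _ s i j])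
  have sq: "(step_fun m s c x)\<^sup>2 = (\<Sum>i<m. (c i)\<^sup>2 * indicator {s i<..s (Suc i)} x)" if "m \<le> n" for m x
    using that
  proof (induction m)
    case (Suc m)
    have "step_fun m s c x * indicator {s m<..s (Suc m)} x = 0"
    proof (cases "s m < x")
      case True
      then have "indicator {s i<..s (Suc i)} x = (0::real)" if "i < m" for i
        using le[of "Suc i" m] that Suc.prems by (auto simp: indicator_def)
      then show ?thesis by (simp add: step_fun_def)
    qed simp
    moreover have "step_fun (Suc m) s c x = step_fun m s c x + c m * indicator {s m<..s (Suc m)} x"
      by (simp add: step_fun_def)
    ultimately show ?case
      using Suc by (auto simp: power2_sum power_mult_distrib indicator_def)
  qed (simp add: step_fun_def)
  have fin: "integrable lborel (\<lambda>x. (c i)\<^sup>2 * indicator {s i<..s (Suc i)} x)" if "i < n" for i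
    using le[of i "Suc i"] that by (intro integrable_mult_right integrable_real_indicator) auto
  have meas: "step_fun n s c \<in> borel_measurable lborel"
    unfolding step_fun_def by measurable
  show "square_integrable lborel (step_fun n s c)"
    unfolding square_integrable_def sq[OF order_refl]
    by (intro conjI meas Bochner_Integration.integrable_sum fin) simp
  show "(\<integral>x. (step_fun n s c x)\<^sup>2 \<partial>lborel) = (\<Sum>i<n. (c i)\<^sup>2 * (s (Suc i) - s i))"
    unfolding sq[OF order_refl] by (subst Bochner_Integration.integral_sum) (use fin le in auto)
qed

text \<open>
  Step functions are written here as combinations of the functions \<open>1\<^bsub>(0, t]\<^esub>\<close>, with \<open>B t\<close> as the integral
  of \<open>1\<^bsub>(0, t]\<^esub>\<close>. Unlike partitions with coefficients, such lists are added by appending them, without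
  a common refinement.
\<close>

definition elementary_kernel :: "(real \<times> real) list \<Rightarrow> real \<Rightarrow> real" where
  "elementary_kernel xs x = (\<Sum>(t, c)\<leftarrow>xs. c * indicator {0<..t} x)"

definition elementary_integral :: "(real \<Rightarrow> 'a \<Rightarrow> real) \<Rightarrow> (real \<times> real) list \<Rightarrow> 'a \<Rightarrow> real" where
  "elementary_integral B xs \<omega> = (\<Sum>(t, c)\<leftarrow>xs. c * B t \<omega>)"

text \<open>
  The refinement is needed only once, to reach the independent increments of \<open>B\<close>: on a grid that
  starts at \<open>0\<close> and contains all the times of the list, both the kernel and the integral telescope.
\<close>

lemma elementary_on_grid:
  assumes s: "strict_mono_on {..n} s" "s 0 = 0" and xs: "fst ` set xs \<subseteq> s ` {..n}"
  obtains c where "\<And>x. elementary_kernel xs x = step_fun n s c x"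
    and "\<And>\<omega>. B 0 \<omega> = 0 \<Longrightarrow> elementary_integral B xs \<omega> = step_integral B n s c \<omega>"
  using xs
proof (induction xs arbitrary: thesis)
  case Nil
  show ?case
    by (rule Nil(1)[of "\<lambda>_. 0"])
       (simp_all add: elementary_kernel_def elementary_integral_def step_fun_def step_integral_def)
next
  case (Cons p xs)
  obtain t a where p: "p = (t, a)" by force
  obtain c where c: "\<And>x. elementary_kernel xs x = step_fun n s c x"
    "\<And>\<omega>. B 0 \<omega> = 0 \<Longrightarrow> elementary_integral B xs \<omega> = step_integral B n s c \<omega>"
    using Cons.IH Cons.prems(2) by auto
  obtain k where k: "k \<le> n" "t = s k" using Cons.prems(2) p by auto
  have lt: "s i < s (Suc i)" if "i < n" for i
    using s(1) that by (auto dest: strict_mono_onD[of _ s i "Suc i"])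
  have ge: "0 \<le> s i" if "i \<le> n" for i
    using s that by (cases "i = 0") (auto dest: strict_mono_onD[of _ s 0 i])
  have tel: "(\<Sum>i<j. indicator {s i<..s (Suc i)} x) = (indicator {0<..s j} x :: real)" if "j \<le> n" for j x
    using that
  proof (induction j)
    case (Suc j)
    then show ?case using lt[of j] ge[of j] by (auto simp: indicator_def)
  qed (simp add: s)
  have telB: "(\<Sum>i<j. B (s (Suc i)) \<omega> - B (s i) \<omega>) = B (s j) \<omega> - B 0 \<omega>" for j \<omega>
    using sum_lessThan_telescope[of "\<lambda>i. B (s i) \<omega>" j] s by simp
  have cut: "(\<Sum>i<n. (if i < k then a else 0) * f i) = a * (\<Sum>i<k. f i)" for f :: "nat \<Rightarrow> real"
    unfolding sum_distrib_left using k
    by (intro sum.mono_neutral_cong_right) auto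
  show ?case
  proof (rule Cons.prems(1))
    show "elementary_kernel (p # xs) x = step_fun n s (\<lambda>i. (if i < k then a else 0) + c i) x" for x
      using c(1)[of x] cut[of "\<lambda>i. indicator {s i<..s (Suc i)} x"] tel[OF k(1), of x]
      by (simp add: elementary_kernel_def step_fun_def p k distrib_right sum.distrib)
    show "elementary_integral B (p # xs) \<omega> = step_integral B n s (\<lambda>i. (if i < k then a else 0) + c i) \<omega>"
      if "B 0 \<omega> = 0" for \<omega>
      using c(2)[OF that] cut[of "\<lambda>i. B (s (Suc i)) \<omega> - B (s i) \<omega>"] telB[of \<omega> k] that
      by (simp add: elementary_integral_def step_integral_def p k distrib_right sum.distrib)
  qed
qed


lemma brownian_measurable: "brownian_motion B \<Longrightarrow> 0 \<le> t \<Longrightarrow> random_variable borel (B t)"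
  by (simp add: brownian_motion_def)

lemma step_integral_char:
  assumes B: "brownian_motion B" and s: "strict_mono_on {..n} s" "0 \<le> s 0"
  shows "expectation (\<lambda>\<omega>. iexp (u * step_integral B n s c \<omega>))
    = exp (- (u\<^sup>2 * (\<integral>x. (step_fun n s c x)\<^sup>2 \<partial>lborel)) / 2)"
proof -
  define D where "D i \<omega> = B (s (Suc i)) \<omega> - B (s i) \<omega>" for i \<omega>
  have lt: "s i < s (Suc i)" if "i < n" for i
    using s(1) that by (auto dest: strict_mono_onD[of _ s i "Suc i"])
  have ge: "0 \<le> s i" if "i \<le> n" for i
    using s that by (cases "i = 0") (auto dest: strict_mono_onD[of _ s 0 i])
  have D: "distributed M lborel (D i) (normal_density 0 (sqrt (s (Suc i) - s i)))" if "i < n" for i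
    using B lt[OF that] ge[of i] that unfolding brownian_motion_def D_def by simp
  have Dm[measurable]: "random_variable borel (D i)" if "i < n" for i
    using D[OF that] by (auto simp: distributed_def)
  have "indep_vars (\<lambda>_. borel) D {..<n}"
    using B s unfolding brownian_motion_def D_def[abs_def] by blast
  then have ind: "indep_vars (\<lambda>_. borel) (\<lambda>i \<omega>. c i * D i \<omega>) {..<n}"
    by (rule indep_vars_compose2) measurable
  have "expectation (\<lambda>\<omega>. iexp (u * step_integral B n s c \<omega>))
      = char (distr M borel (\<lambda>\<omega>. \<Sum>i<n. c i * D i \<omega>)) u"
    unfolding char_def
    by (subst integral_distr) (auto simp: step_integral_def D_def[symmetric]
      intro!: borel_measurable_sum)
  also have "\<dots> = (\<Prod>i<n. char (distr M borel (\<lambda>\<omega>. c i * D i \<omega>)) u)"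
    by (rule char_distr_sum[OF ind])
  also have "\<dots> = (\<Prod>i<n. complex_of_real (exp (- (u\<^sup>2 * ((c i)\<^sup>2 * (s (Suc i) - s i))) / 2)))"
  proof (intro prod.cong refl)
    fix i assume "i \<in> {..<n}"
    then have i: "i < n" by simp
    have "char (distr M borel (\<lambda>\<omega>. c i * D i \<omega>)) u = expectation (\<lambda>\<omega>. iexp ((u * c i) * D i \<omega>))"
      unfolding char_def using Dm[OF i] by (subst integral_distr) (auto simp: mult.assoc)
    also have "\<dots> = exp (- ((u * c i)\<^sup>2 * (sqrt (s (Suc i) - s i))\<^sup>2) / 2)"
      using lt[OF i] D[OF i] by (intro char_centered_normal) auto
    finally show "char (distr M borel (\<lambda>\<omega>. c i * D i \<omega>)) u
      = exp (- (u\<^sup>2 * ((c i)\<^sup>2 * (s (Suc i) - s i))) / 2)"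
      using lt[OF i] by (simp add: power_mult_distrib mult.assoc)
  qed
  also have "\<dots> = exp (- (u\<^sup>2 * (\<Sum>i<n. (c i)\<^sup>2 * (s (Suc i) - s i))) / 2)"
    by (simp only: of_real_prod[symmetric] exp_sum[symmetric] finite_lessThan)
       (simp add: sum_negf[symmetric] sum_distrib_left sum_divide_distrib)
  finally show ?thesis by (simp add: step_fun_square_has_integral(2)[OF s(1)])
qed

lemma elementary_measurable:
  assumes "brownian_motion B" "fst ` set xs \<subseteq> {0..}"
  shows "random_variable borel (elementary_integral B xs)"
  using assms(2)
proof (induction xs)
  case (Cons p xs)
  then have [measurable]: "random_variable borel (B (fst p))"
    "random_variable borel (elementary_integral B xs)"
    using brownian_measurable[OF assms(1)] by auto
  have "elementary_integral B (p # xs) = (\<lambda>\<omega>. snd p * B (fst p) \<omega> + elementary_integral B xs \<omega>)"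
    by (auto simp: elementary_integral_def fun_eq_iff split: prod.split)
  then show ?case by simp
qed (simp add: elementary_integral_def[abs_def])

lemma elementary_gaussian:
  assumes B: "brownian_motion B" and xs: "fst ` set xs \<subseteq> {0..}"
  shows "square_integrable lborel (elementary_kernel xs)"
    and "expectation (\<lambda>\<omega>. iexp (u * elementary_integral B xs \<omega>))
      = exp (- (u\<^sup>2 * (\<integral>x. (elementary_kernel xs x)\<^sup>2 \<partial>lborel)) / 2)"
proof -
  obtain n s where s: "strict_mono_on {..n::nat} s" "s 0 = 0" "fst ` set xs \<subseteq> s ` {..n}"
    using grid_exists[OF _ xs] by auto
  obtain c where c: "\<And>x. elementary_kernel xs x = step_fun n s c x"
    "\<And>\<omega>. B 0 \<omega> = 0 \<Longrightarrow> elementary_integral B xs \<omega> = step_integral B n s c \<omega>"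
    using elementary_on_grid[OF s] by blast
  have eq: "elementary_kernel xs = step_fun n s c" using c by auto
  show "square_integrable lborel (elementary_kernel xs)"
    unfolding eq by (rule step_fun_square_has_integral[OF s(1)])
  note [measurable] = elementary_measurable[OF B xs]
  have "0 \<le> s i" if "i \<le> n" for i
    using s that by (cases "i = 0") (auto dest: strict_mono_onD[of _ s 0 i])
  then have "random_variable borel (step_integral B n s c)"
    unfolding step_integral_def[abs_def]
    by (intro borel_measurable_sum borel_measurable_times borel_measurable_diff
      brownian_measurable[OF B]) auto
  moreover have "AE \<omega> in M. B 0 \<omega> = 0" using B by (simp add: brownian_motion_def)
  ultimately have "expectation (\<lambda>\<omega>. iexp (u * elementary_integral B xs \<omega>))
    = expectation (\<lambda>\<omega>. iexp (u * step_integral B n s c \<omega>))"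
    by (intro integral_cong_AE) (auto simp: c)
  then show "expectation (\<lambda>\<omega>. iexp (u * elementary_integral B xs \<omega>))
      = exp (- (u\<^sup>2 * (\<integral>x. (elementary_kernel xs x)\<^sup>2 \<partial>lborel)) / 2)"
    unfolding eq using step_integral_char[OF B s(1)] s(2) by simp
qed

text \<open>
  The closure in \<open>L2 \<times> L2\<close> of the linear graph of the elementary integral. All that is used about
  Wiener integrals below is that this relation is linear (\<open>wiener_pair_add\<close>, \<open>wiener_pair_scale\<close>)
  and that \<open>Y\<close> has the characteristic function of a centered normal variable whose variance is the
  squared norm of its kernel \<open>f\<close> (\<open>wiener_pair_char\<close>).
\<close>

definition wiener_pair :: "(real \<Rightarrow> 'a \<Rightarrow> real) \<Rightarrow> (real \<Rightarrow> real) \<Rightarrow> ('a \<Rightarrow> real) \<Rightarrow> bool" where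
  "wiener_pair B f Y \<longleftrightarrow> square_integrable lborel f \<and> random_variable borel Y \<and>
     (\<exists>xs. (\<forall>k::nat. fst ` set (xs k) \<subseteq> {0..}) \<and>
       (\<lambda>k. \<integral>\<^sup>+x. ennreal ((f x - elementary_kernel (xs k) x)\<^sup>2) \<partial>lborel) \<longlonglongrightarrow> 0 \<and>
       (\<lambda>k. \<integral>\<^sup>+\<omega>. ennreal ((Y \<omega> - elementary_integral B (xs k) \<omega>)\<^sup>2) \<partial>M) \<longlonglongrightarrow> 0)"

lemma wiener_pair_square_integrable: "wiener_pair B f Y \<Longrightarrow> square_integrable lborel f"
  and wiener_pair_measurable: "wiener_pair B f Y \<Longrightarrow> random_variable borel Y"
  by (auto simp: wiener_pair_def)

lemma wiener_pair_zero: "(\<And>\<omega>. \<omega> \<in> space M \<Longrightarrow> Y \<omega> = 0) \<Longrightarrow> wiener_pair B (\<lambda>_. 0) Y"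
  unfolding wiener_pair_def
  by (auto simp: elementary_kernel_def elementary_integral_def measurable_cong[of M Y "\<lambda>_. 0"]
      cong: nn_integral_cong intro!: exI[of _ "\<lambda>_. []"])

lemma wiener_pair_scale:
  assumes B: "brownian_motion B" and w: "wiener_pair B f Y"
    and Y': "\<And>\<omega>. \<omega> \<in> space M \<Longrightarrow> Y' \<omega> = a * Y \<omega>"
  shows "wiener_pair B (\<lambda>x. a * f x) Y'"
proof -
  obtain xs where xs: "\<And>k::nat. fst ` set (xs k) \<subseteq> {0..}"
      and f: "(\<lambda>k. \<integral>\<^sup>+x. ennreal ((f x - elementary_kernel (xs k) x)\<^sup>2) \<partial>lborel) \<longlonglongrightarrow> 0"
      and Y: "(\<lambda>k. \<integral>\<^sup>+\<omega>. ennreal ((Y \<omega> - elementary_integral B (xs k) \<omega>)\<^sup>2) \<partial>M) \<longlonglongrightarrow> 0"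
    using w unfolding wiener_pair_def by auto
  have [measurable]: "random_variable borel Y" "f \<in> borel_measurable borel"
    using w by (auto simp: wiener_pair_def square_integrable_def)
  note [measurable] = elementary_measurable[OF B xs]
  have [measurable]: "elementary_kernel (xs k) \<in> borel_measurable borel" for k
    using elementary_gaussian(1)[OF B xs] by (auto simp: square_integrable_def)
  have Ym: "random_variable borel Y'"
    using Y' by (subst measurable_cong[of M Y' "\<lambda>\<omega>. a * Y \<omega>"]) auto
  define ys where "ys k = map (\<lambda>(t, c). (t, a * c)) (xs k)" for k
  have ys: "fst ` set (ys k) \<subseteq> {0..}" for k
    using xs[of k] by (force simp: ys_def)
  have k: "elementary_kernel (ys k) x = a * elementary_kernel (xs k) x" for k x
    by (simp add: ys_def elementary_kernel_def sum_list_const_mult[symmetric] comp_def split_beta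
      mult.assoc)
  have i: "elementary_integral B (ys k) \<omega> = a * elementary_integral B (xs k) \<omega>" for k \<omega>
    by (simp add: ys_def elementary_integral_def sum_list_const_mult[symmetric] comp_def split_beta
      mult.assoc)
  have "(\<integral>\<^sup>+x. ennreal ((a * f x - elementary_kernel (ys k) x)\<^sup>2) \<partial>lborel)
      = ennreal (a\<^sup>2) * (\<integral>\<^sup>+x. ennreal ((f x - elementary_kernel (xs k) x)\<^sup>2) \<partial>lborel)" for k
    by (subst nn_integral_cmult[symmetric])
       (auto simp: k ennreal_mult[symmetric] power_mult_distrib[symmetric] right_diff_distrib)
  moreover have "(\<lambda>k. ennreal (a\<^sup>2)
    * (\<integral>\<^sup>+x. ennreal ((f x - elementary_kernel (xs k) x)\<^sup>2) \<partial>lborel)) \<longlonglongrightarrow> ennreal (a\<^sup>2) * 0"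
    by (intro ennreal_tendsto_cmult f) simp
  moreover have "(\<integral>\<^sup>+\<omega>. ennreal ((Y' \<omega> - elementary_integral B (ys k) \<omega>)\<^sup>2) \<partial>M)
      = ennreal (a\<^sup>2) * (\<integral>\<^sup>+\<omega>. ennreal ((Y \<omega> - elementary_integral B (xs k) \<omega>)\<^sup>2) \<partial>M)" for k
    by (subst nn_integral_cmult[symmetric])
       (auto simp: i Y' ennreal_mult[symmetric] power_mult_distrib[symmetric] right_diff_distrib
         intro!: nn_integral_cong)
  moreover have "(\<lambda>k. ennreal (a\<^sup>2) * (\<integral>\<^sup>+\<omega>. ennreal ((Y \<omega> - elementary_integral B (xs k) \<omega>)\<^sup>2) \<partial>M))
    \<longlonglongrightarrow> ennreal (a\<^sup>2) * 0"
    by (intro ennreal_tendsto_cmult Y) simp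
  ultimately show ?thesis
    unfolding wiener_pair_def using ys Ym
    by (intro conjI exI[of _ ys] allI square_integrable_scale wiener_pair_square_integrable[OF w])
      simp_all
qed

lemma wiener_pair_add:
  assumes B: "brownian_motion B" and 1: "wiener_pair B f Y" and 2: "wiener_pair B g Z"
  shows "wiener_pair B (\<lambda>x. f x + g x) (\<lambda>\<omega>. Y \<omega> + Z \<omega>)"
proof -
  obtain xs where xs: "\<And>k::nat. fst ` set (xs k) \<subseteq> {0..}"
      and f: "(\<lambda>k. \<integral>\<^sup>+x. ennreal ((f x - elementary_kernel (xs k) x)\<^sup>2) \<partial>lborel) \<longlonglongrightarrow> 0"
      and Y: "(\<lambda>k. \<integral>\<^sup>+\<omega>. ennreal ((Y \<omega> - elementary_integral B (xs k) \<omega>)\<^sup>2) \<partial>M) \<longlonglongrightarrow> 0"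
    using 1 unfolding wiener_pair_def by auto
  obtain ys where ys: "\<And>k::nat. fst ` set (ys k) \<subseteq> {0..}"
      and g: "(\<lambda>k. \<integral>\<^sup>+x. ennreal ((g x - elementary_kernel (ys k) x)\<^sup>2) \<partial>lborel) \<longlonglongrightarrow> 0"
      and Z: "(\<lambda>k. \<integral>\<^sup>+\<omega>. ennreal ((Z \<omega> - elementary_integral B (ys k) \<omega>)\<^sup>2) \<partial>M) \<longlonglongrightarrow> 0"
    using 2 unfolding wiener_pair_def by auto
  have [measurable]: "random_variable borel Y" "f \<in> borel_measurable borel"
    "random_variable borel Z" "g \<in> borel_measurable borel"
    using 1 2 by (auto simp: wiener_pair_def square_integrable_def)
  note [measurable] = elementary_measurable[OF B xs] elementary_measurable[OF B ys]
  have [measurable]: "elementary_kernel (xs k) \<in> borel_measurable borel"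
    "elementary_kernel (ys k) \<in> borel_measurable borel" for k
    using elementary_gaussian(1)[OF B xs] elementary_gaussian(1)[OF B ys]
      by (auto simp: square_integrable_def)
  have k: "f x + g x - elementary_kernel (xs k @ ys k) x
    = (f x - elementary_kernel (xs k) x) + (g x - elementary_kernel (ys k) x)" for k x
    by (simp add: elementary_kernel_def)
  have i: "Y \<omega> + Z \<omega> - elementary_integral B (xs k @ ys k) \<omega>
    = (Y \<omega> - elementary_integral B (xs k) \<omega>) + (Z \<omega> - elementary_integral B (ys k) \<omega>)" for k \<omega>
    by (simp add: elementary_integral_def)
  have "(\<lambda>k. \<integral>\<^sup>+x. ennreal ((f x + g x - elementary_kernel (xs k @ ys k) x)\<^sup>2) \<partial>lborel) \<longlonglongrightarrow> 0"
    unfolding k by (intro nn_square_add_tendsto f g) auto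
  moreover have "(\<lambda>k. \<integral>\<^sup>+\<omega>. ennreal ((Y \<omega> + Z \<omega> - elementary_integral B (xs k @ ys k) \<omega>)\<^sup>2) \<partial>M) \<longlonglongrightarrow> 0"
    unfolding i by (intro nn_square_add_tendsto Y Z) auto
  moreover have "fst ` set (xs k @ ys k) \<subseteq> {0..}" for k using xs[of k] ys[of k] by auto
  ultimately show ?thesis
    unfolding wiener_pair_def using 1 2
    by (intro conjI square_integrable_add exI[of _ "\<lambda>k. xs k @ ys k"]) (auto simp: wiener_pair_def)
qed

lemma wiener_pair_sum:
  assumes B: "brownian_motion B" and "\<And>j. j \<in> J \<Longrightarrow> wiener_pair B (f j) (Y j)" 
  shows "wiener_pair B (\<lambda>x. \<Sum>j\<in>J. c j * f j x) (\<lambda>\<omega>. \<Sum>j\<in>J. c j * Y j \<omega>)"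
  using assms(2)
  by (induction J rule: infinite_finite_induct)
     (auto intro!: wiener_pair_zero wiener_pair_add[OF B] wiener_pair_scale[OF B])

text \<open>
  The map \<open>x \<mapsto> exp (\<i> u x)\<close> has Lipschitz constant \<open>\<bar>u\<bar>\<close>, and the \<open>L1\<close> norm of a random variable is at
  most its \<open>L2\<close> norm.
\<close>

lemma char_tendsto_of_L2:
  assumes [measurable]: "random_variable borel Y" "\<And>k::nat. random_variable borel (Z k)"
    and lim: "(\<lambda>k. \<integral>\<^sup>+\<omega>. ennreal ((Y \<omega> - Z k \<omega>)\<^sup>2) \<partial>M) \<longlonglongrightarrow> 0"
  shows "(\<lambda>k. expectation (\<lambda>\<omega>. iexp (u * Z k \<omega>))) \<longlonglongrightarrow> expectation (\<lambda>\<omega>. iexp (u * Y \<omega>))"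
proof -
  define h where "h k \<omega> = iexp (u * Z k \<omega>) - iexp (u * Y \<omega>)" for k \<omega>
  have [measurable]: "h k \<in> borel_measurable M" for k unfolding h_def by measurable
  have ie: "integrable M (\<lambda>\<omega>. iexp (u * Z k \<omega>))" "integrable M (\<lambda>\<omega>. iexp (u * Y \<omega>))" for k
    by (intro integrable_iexp; simp)+
  then have ih: "integrable M (h k)" for k unfolding h_def by simp
  have lip: "cmod (iexp a - iexp b) \<le> \<bar>a - b\<bar>" for a b
  proof -
    have "iexp a - iexp b = iexp b * (iexp (a - b) - 1)"
      by (simp add: right_diff_distrib exp_diff)
    then show ?thesis
      using iexp_approx1[of "a - b" 0] by (simp add: norm_mult)
  qed
  have bound: "ennreal ((\<integral>\<omega>. cmod (h k \<omega>) \<partial>M)\<^sup>2)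
    \<le> ennreal (u\<^sup>2) * (\<integral>\<^sup>+\<omega>. ennreal ((Y \<omega> - Z k \<omega>)\<^sup>2) \<partial>M)" for k
  proof -
    have "ennreal ((\<integral>\<omega>. cmod (h k \<omega>) \<partial>M)\<^sup>2) = (\<integral>\<^sup>+\<omega>. ennreal (cmod (h k \<omega>)) * 1 \<partial>M)\<^sup>2"
      using ih[of k] by (simp add: nn_integral_eq_integral ennreal_power)
    also have "\<dots> \<le> (\<integral>\<^sup>+\<omega>. (ennreal (cmod (h k \<omega>)))\<^sup>2 \<partial>M) * (\<integral>\<^sup>+\<omega>. 1\<^sup>2 \<partial>M)"
      by (rule Cauchy_Schwarz_nn_integral) auto
    also have "\<dots> = (\<integral>\<^sup>+\<omega>. ennreal ((cmod (h k \<omega>))\<^sup>2) \<partial>M)"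
      by (simp add: ennreal_power emeasure_space_1)
    also have "\<dots> \<le> (\<integral>\<^sup>+\<omega>. ennreal (u\<^sup>2) * ennreal ((Y \<omega> - Z k \<omega>)\<^sup>2) \<partial>M)"
    proof (intro nn_integral_mono)
      fix \<omega>
      have "cmod (h k \<omega>) \<le> \<bar>u * (Y \<omega> - Z k \<omega>)\<bar>"
        using lip[of "u * Z k \<omega>" "u * Y \<omega>"] by (simp add: h_def right_diff_distrib abs_minus_commute)
      then have "(cmod (h k \<omega>))\<^sup>2 \<le> u\<^sup>2 * (Y \<omega> - Z k \<omega>)\<^sup>2"
        using power_mono[of "cmod (h k \<omega>)" "\<bar>u * (Y \<omega> - Z k \<omega>)\<bar>" 2] by (simp add: power_mult_distrib)
      then show "ennreal ((cmod (h k \<omega>))\<^sup>2) \<le> ennreal (u\<^sup>2) * ennreal ((Y \<omega> - Z k \<omega>)\<^sup>2)"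
        by (simp add: ennreal_mult[symmetric] ennreal_leI)
    qed
    finally show ?thesis by (simp add: nn_integral_cmult)
  qed
  have "(\<lambda>k. ennreal (u\<^sup>2) * (\<integral>\<^sup>+\<omega>. ennreal ((Y \<omega> - Z k \<omega>)\<^sup>2) \<partial>M)) \<longlonglongrightarrow> ennreal (u\<^sup>2) * 0"
    by (intro ennreal_tendsto_cmult lim) simp
  then have lim': "(\<lambda>k. ennreal (u\<^sup>2) * (\<integral>\<^sup>+\<omega>. ennreal ((Y \<omega> - Z k \<omega>)\<^sup>2) \<partial>M)) \<longlonglongrightarrow> 0" by simp
  have "(\<lambda>k. ennreal ((\<integral>\<omega>. cmod (h k \<omega>) \<partial>M)\<^sup>2)) \<longlonglongrightarrow> 0"
    by (rule tendsto_sandwich[OF _ _ tendsto_const lim'])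
      (simp, rule always_eventually, rule allI, rule bound)
  then have "(\<lambda>k. ennreal ((\<integral>\<omega>. cmod (h k \<omega>) \<partial>M)\<^sup>2)) \<longlonglongrightarrow> ennreal 0" by simp
  then have "(\<lambda>k. (\<integral>\<omega>. cmod (h k \<omega>) \<partial>M)\<^sup>2) \<longlonglongrightarrow> 0"
    by (subst (asm) tendsto_ennreal_iff) auto
  then have "(\<lambda>k. sqrt ((\<integral>\<omega>. cmod (h k \<omega>) \<partial>M)\<^sup>2)) \<longlonglongrightarrow> sqrt 0"
    by (intro tendsto_intros)
  then have lim0: "(\<lambda>k. \<integral>\<omega>. cmod (h k \<omega>) \<partial>M) \<longlonglongrightarrow> 0" by simp
  show ?thesis
  proof (rule LIM_zero_cancel, rule Lim_null_comparison[OF _ lim0], rule always_eventually, rule allI)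
    fix k
    have "expectation (\<lambda>\<omega>. iexp (u * Z k \<omega>)) - expectation (\<lambda>\<omega>. iexp (u * Y \<omega>)) = (\<integral>\<omega>. h k \<omega> \<partial>M)"
      unfolding h_def using ie by simp
    then show "cmod (expectation (\<lambda>\<omega>. iexp (u * Z k \<omega>)) - expectation (\<lambda>\<omega>. iexp (u * Y \<omega>)))
      \<le> (\<integral>\<omega>. cmod (h k \<omega>) \<partial>M)"
      using integral_norm_bound[of M "h k"] by simp
  qed
qed

lemma wiener_pair_char:
  assumes B: "brownian_motion B" and w: "wiener_pair B f Y"
  shows "expectation (\<lambda>\<omega>. iexp (u * Y \<omega>)) = exp (- (u\<^sup>2 * (\<integral>x. (f x)\<^sup>2 \<partial>lborel)) / 2)"
proof -
  obtain xs where xs: "\<And>k::nat. fst ` set (xs k) \<subseteq> {0..}"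
      and f: "(\<lambda>k. \<integral>\<^sup>+x. ennreal ((f x - elementary_kernel (xs k) x)\<^sup>2) \<partial>lborel) \<longlonglongrightarrow> 0"
      and Y: "(\<lambda>k. \<integral>\<^sup>+\<omega>. ennreal ((Y \<omega> - elementary_integral B (xs k) \<omega>)\<^sup>2) \<partial>M) \<longlonglongrightarrow> 0"
    using w unfolding wiener_pair_def by auto
  have "(\<lambda>k. expectation (\<lambda>\<omega>. iexp (u * elementary_integral B (xs k) \<omega>)))
    \<longlonglongrightarrow> expectation (\<lambda>\<omega>. iexp (u * Y \<omega>))"
    using w by (intro char_tendsto_of_L2 Y elementary_measurable[OF B xs]) (auto simp: wiener_pair_def)
  moreover have "(\<lambda>k. \<integral>x. (elementary_kernel (xs k) x)\<^sup>2 \<partial>lborel) \<longlonglongrightarrow> (\<integral>x. (f x)\<^sup>2 \<partial>lborel)"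
    using w by (intro square_integral_tendsto f elementary_gaussian(1)[OF B xs]) (auto
      simp: wiener_pair_def)
  then have "(\<lambda>k. complex_of_real (exp (- (u\<^sup>2 * (\<integral>x. (elementary_kernel (xs k) x)\<^sup>2 \<partial>lborel)) / 2)))
      \<longlonglongrightarrow> complex_of_real (exp (- (u\<^sup>2 * (\<integral>x. (f x)\<^sup>2 \<partial>lborel)) / 2))"
    by (intro tendsto_intros) auto
  ultimately show ?thesis
    unfolding elementary_gaussian(2)[OF B xs] by (rule LIMSEQ_unique)
qed

end

context prob_space
begin

lemma wiener_pair_of_has_wiener_integral:
  assumes B: "brownian_motion B" and w: "has_wiener_integral B f t Y"
  shows "wiener_pair B (\<lambda>x. indicator {0..t} x * f x) Y"
proof -
  obtain n s c where s: "\<And>k::nat. 0 \<le> s k 0" "\<And>k. strict_mono_on {..n k} (s k)" "\<And>k. s k (n k) \<le> t"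
    and f: "(\<lambda>k. \<integral>\<^sup>+x\<in>{0..t}. ennreal ((f x - step_fun (n k) (s k) (c k) x)\<^sup>2) \<partial>lborel) \<longlonglongrightarrow> 0"
    and Y: "(\<lambda>k. \<integral>\<^sup>+\<omega>. ennreal ((Y \<omega> - step_integral B (n k) (s k) (c k) \<omega>)\<^sup>2) \<partial>M) \<longlonglongrightarrow> 0"
    using w unfolding has_wiener_integral_def by blast
  have le: "s k i \<le> s k j" if "i \<le> j" "j \<le> n k" for k i j
    using s(2)[of k] that by (cases "i = j") (auto dest: strict_mono_onD[of _ "s k" i j])
  have ge: "0 \<le> s k i" if "i \<le> n k" for k i
    using le[of 0 i k] s(1)[of k] that by simp
  define xs where "xs k = concat (map (\<lambda>i. [(s k (Suc i), c k i), (s k i, - c k i)]) [0..<n k])" for k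
  have xs: "fst ` set (xs k) \<subseteq> {0..}" for k
    using ge[of _ k] by (auto simp: xs_def)
  have sum2: "(\<Sum>(t, a)\<leftarrow>xs k. a * g t) = (\<Sum>i<n k. c k i * (g (s k (Suc i)) - g (s k i)))"
    for k and g :: "real \<Rightarrow> real"
  proof -
    have "(\<Sum>(t, a)\<leftarrow>concat (map (\<lambda>i. [(s k (Suc i), c k i), (s k i, - c k i)]) [0..<m]). a * g t)
        = (\<Sum>i<m. c k i * (g (s k (Suc i)) - g (s k i)))" for m
      by (induction m) (simp_all add: right_diff_distrib)
    then show ?thesis by (simp add: xs_def)
  qed
  have K: "elementary_kernel (xs k) x = step_fun (n k) (s k) (c k) x" for k x
    unfolding elementary_kernel_def step_fun_def sum2
  proof (intro sum.cong refl)
    fix i assume "i \<in> {..<n k}"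
    then show "c k i * (indicator {0<..s k (Suc i)} x - indicator {0<..s k i} x)
      = c k i * indicator {s k i<..s k (Suc i)} x"
      using ge[of i k] le[of i "Suc i" k] by (auto simp: indicator_def)
  qed
  have I: "elementary_integral B (xs k) \<omega> = step_integral B (n k) (s k) (c k) \<omega>" for k \<omega>
    unfolding elementary_integral_def step_integral_def sum2 ..
  have out: "step_fun (n k) (s k) (c k) x = 0" if "x \<notin> {0..t}" for k x
    unfolding step_fun_def
  proof (intro sum.neutral ballI)
    fix i assume "i \<in> {..<n k}"
    then show "c k i * indicator {s k i<..s k (Suc i)} x = 0"
      using that ge[of i k] le[of "Suc i" "n k" k] s(3)[of k] by (auto simp: indicator_def)
  qed
  have "(\<integral>\<^sup>+x\<in>{0..t}. ennreal ((f x - step_fun (n k) (s k) (c k) x)\<^sup>2) \<partial>lborel)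
      = (\<integral>\<^sup>+x. ennreal ((indicator {0..t} x * f x - elementary_kernel (xs k) x)\<^sup>2) \<partial>lborel)" for k
    unfolding K by (intro nn_integral_cong) (simp add: indicator_def out)
  then have f': "(\<lambda>k. \<integral>\<^sup>+x. ennreal ((indicator {0..t} x * f x - elementary_kernel (xs k) x)\<^sup>2)
    \<partial>lborel) \<longlonglongrightarrow> 0"
    using f by simp
  have "square_integrable lborel (\<lambda>x. indicator {0..t} x * f x)"
  proof -
    have "(indicator {0..t} x * f x)\<^sup>2 = indicator {0..t} x * (f x)\<^sup>2" for x
      by (simp add: indicator_def)
    then show ?thesis
      using w unfolding has_wiener_integral_def square_integrable_def set_borel_measurable_def
        set_integrable_def
      by simp
  qed
  then show ?thesis
    unfolding wiener_pair_def using xs f' Y w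
    by (auto simp: I has_wiener_integral_def intro!: exI[of _ xs])
qed

text \<open>
  The degenerate case is separate because a normal density exists only for positive variance.
\<close>

lemma centered_normal_char_cases:
  assumes Y[measurable]: "random_variable borel Y" and "0 \<le> v"
    and char: "\<And>u. expectation (\<lambda>\<omega>. iexp (u * Y \<omega>)) = exp (- (u\<^sup>2 * v) / 2)"
  shows "v = 0 \<Longrightarrow> AE \<omega> in M. Y \<omega> = 0"
    and "0 < v \<Longrightarrow> distributed M lborel Y (normal_density 0 (sqrt v))"
proof -
  interpret D: prob_space "distr M borel Y" by (rule prob_space_distr) simp
  have charD: "(\<integral>x. iexp (u * x) \<partial>distr M borel Y) = exp (- (u\<^sup>2 * v) / 2)" for u
    by (subst integral_distr) (simp_all only: char measurable, measurable)
  show "AE \<omega> in M. Y \<omega> = 0" if "v = 0"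
  proof -
    interpret R: prob_space "return borel (0::real)" by (rule prob_space_return) simp
    have eq: "distr M borel Y = return borel 0"
    proof (rule finite_measure_char_eqI)
      fix u show "(\<integral>x. iexp (u * x) \<partial>distr M borel Y) = (\<integral>x. iexp (u * x) \<partial>return borel 0)"
        unfolding charD using that by (subst integral_return) auto
    qed (simp_all add: D.finite_measure_axioms R.finite_measure_axioms)
    have "AE x in distr M borel Y. x = 0"
      unfolding eq by (subst AE_return) auto
    then show ?thesis by (subst (asm) AE_distr_iff) auto
  qed
  show "distributed M lborel Y (normal_density 0 (sqrt v))" if "0 < v"
  proof -
    let ?N = "density lborel (normal_density 0 (sqrt v))"
    interpret N: prob_space ?N using that by (intro prob_space_normal_density) simp
    have "distributed ?N lborel (\<lambda>x. x) (normal_density 0 (sqrt v))"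
      by (auto simp: distributed_def distr_id2)
    note N = N.char_centered_normal[OF _ this]
    have "distr M borel Y = ?N"
    proof (rule finite_measure_char_eqI)
      fix u show "(\<integral>x. iexp (u * x) \<partial>distr M borel Y) = (\<integral>x. iexp (u * x) \<partial>?N)"
        unfolding charD using N[of u] that by simp
    qed (simp_all add: D.finite_measure_axioms N.finite_measure_axioms)
    moreover have "distr M lborel Y = distr M borel Y" by (rule distr_cong) auto
    ultimately show ?thesis by (simp add: distributed_def)
  qed
qed

lemma wiener_pair_gaussian:
  assumes B: "brownian_motion B" and w: "wiener_pair B f Y"
  shows "gaussian_rv Y"
    and "integrable M Y" "expectation Y = 0"
    and "integrable M (\<lambda>\<omega>. (Y \<omega>)\<^sup>2)" "expectation (\<lambda>\<omega>. (Y \<omega>)\<^sup>2) = (\<integral>x. (f x)\<^sup>2 \<partial>lborel)"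
proof -
  define v where "v = (\<integral>x. (f x)\<^sup>2 \<partial>lborel)"
  have v: "0 \<le> v" by (simp add: v_def)
  have Y[measurable]: "random_variable borel Y" using w by (rule wiener_pair_measurable)
  note cases = centered_normal_char_cases[OF Y v wiener_pair_char[OF B w, folded v_def]]
  have "gaussian_rv Y \<and> integrable M Y \<and> expectation Y = 0 \<and> integrable M (\<lambda>\<omega>. (Y \<omega>)\<^sup>2)
    \<and> expectation (\<lambda>\<omega>. (Y \<omega>)\<^sup>2) = v"
  proof (cases "v = 0")
    case True
    have ae: "AE \<omega> in M. Y \<omega> = 0" using cases(1)[OF True] .
    then have ae2: "AE \<omega> in M. (Y \<omega>)\<^sup>2 = 0" by auto
    have "integrable M Y \<longleftrightarrow> integrable M (\<lambda>_. 0::real)" "expectation Y = expectation (\<lambda>_. 0::real)"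
      using ae by (intro integrable_cong_AE integral_cong_AE; simp)+
    moreover have "integrable M (\<lambda>\<omega>. (Y \<omega>)\<^sup>2)
      \<longleftrightarrow> integrable M (\<lambda>_. 0::real)" "expectation (\<lambda>\<omega>. (Y \<omega>)\<^sup>2) = expectation (\<lambda>_. 0::real)"
      using ae2 by (intro integrable_cong_AE integral_cong_AE; simp)+
    ultimately show ?thesis using ae True by (auto simp: gaussian_rv_def)
  next
    case False
    then have pos: "0 < v" using v by simp
    have D: "distributed M lborel Y (normal_density 0 (sqrt v))" using cases(2)[OF pos] .
    have "gaussian_rv Y"
      unfolding gaussian_rv_def using D pos Y real_sqrt_gt_zero[OF pos] by blast
    moreover have "integrable M Y"
      using distributed_integrable[OF D, of "\<lambda>x. x"] integrable_normal_moment_nz_1[of "sqrt v" 0]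
        pos by simp
    moreover have E0: "expectation Y = 0"
      using normal_distributed_expectation[OF _ D] pos by simp
    moreover have "integrable M (\<lambda>\<omega>. (Y \<omega>)\<^sup>2)"
      using distributed_integrable[OF D, of "\<lambda>x. x\<^sup>2"] integrable_normal_moment[of "sqrt v" 0 2] pos
        by simp
    moreover have "expectation (\<lambda>\<omega>. (Y \<omega>)\<^sup>2) = v"
      using normal_distributed_variance[OF _ D] pos E0 by simp
    ultimately show ?thesis by blast
  qed
  then show "gaussian_rv Y" "integrable M Y" "expectation Y = 0"
    "integrable M (\<lambda>\<omega>. (Y \<omega>)\<^sup>2)" "expectation (\<lambda>\<omega>. (Y \<omega>)\<^sup>2) = (\<integral>x. (f x)\<^sup>2 \<partial>lborel)"
    by (auto simp: v_def)
qed

lemma wiener_pair_diff: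
  assumes B: "brownian_motion B" and "wiener_pair B f Y" "wiener_pair B g Z"
  shows "wiener_pair B (\<lambda>x. f x - g x) (\<lambda>\<omega>. Y \<omega> - Z \<omega>)"
  using wiener_pair_add[OF B assms(2) wiener_pair_scale[OF B assms(3), of "\<lambda>\<omega>. - 1 * Z \<omega>" "- 1"]]
    by simp

text \<open>
  Every combination \<open>u W + \<Sum> v j Z j\<close> is again a Wiener integral, and its characteristic function
  depends only on the squared norm of its kernel. Orthogonality splits this norm into two summands,
  so the characteristic function factorises.
\<close>

lemma wiener_pair_orthogonal_indep:
  fixes J :: "'i set"
  assumes B: "brownian_motion B" and J: "finite J"
    and Z: "\<And>j. j \<in> J \<Longrightarrow> wiener_pair B (z j) (Z j)" and W: "wiener_pair B w W"
    and orth: "\<And>j. j \<in> J \<Longrightarrow> (\<integral>x. w x * z j x \<partial>lborel) = 0"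
    and k: "k \<in> borel_measurable (\<Pi>\<^sub>M j\<in>J. (borel :: real measure))"
  shows "indep_var borel W borel (\<lambda>\<omega>. k (\<lambda>j\<in>J. Z j \<omega>) :: real)"
proof (rule indep_var_of_char[OF wiener_pair_measurable[OF W] wiener_pair_measurable[OF Z] J _ k])
  fix u :: real and v :: "'i \<Rightarrow> real"
  define g where "g x = (\<Sum>j\<in>J. v j * z j x)" for x
  have G: "wiener_pair B g (\<lambda>\<omega>. \<Sum>j\<in>J. v j * Z j \<omega>)"
    unfolding g_def by (rule wiener_pair_sum[OF B Z])
  have UW: "wiener_pair B (\<lambda>x. u * w x) (\<lambda>\<omega>. u * W \<omega>)"
    by (rule wiener_pair_scale[OF B W]) simp
  have sw: "square_integrable lborel w" and sg: "square_integrable lborel g"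
    and sz: "\<And>j. j \<in> J \<Longrightarrow> square_integrable lborel (z j)"
    using W G Z by (auto simp: wiener_pair_def)
  have "(\<integral>x. w x * g x \<partial>lborel) = (\<integral>x. (\<Sum>j\<in>J. v j * (w x * z j x)) \<partial>lborel)"
    by (simp add: g_def sum_distrib_left mult_ac)
  also have "\<dots> = (\<Sum>j\<in>J. v j * (\<integral>x. w x * z j x \<partial>lborel))"
    using square_integrable_mult[OF sw sz] by simp
  finally have wg: "(\<integral>x. w x * g x \<partial>lborel) = 0" using orth by simp
  have "(\<integral>x. (u * w x + g x)\<^sup>2 \<partial>lborel) = (\<integral>x. u\<^sup>2 * (w x)\<^sup>2 + (g x)\<^sup>2 + (2 * u) * (w x * g x) \<partial>lborel)"
    by (simp add: power2_sum power_mult_distrib mult_ac)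
  also have "\<dots> = u\<^sup>2 * (\<integral>x. (w x)\<^sup>2 \<partial>lborel) + (\<integral>x. (g x)\<^sup>2 \<partial>lborel)"
    using square_integrable_mult[OF sw sg] sw sg wg by (simp add: square_integrable_def)
  finally have norm: "(\<integral>x. (u * w x + g x)\<^sup>2 \<partial>lborel)
    = u\<^sup>2 * (\<integral>x. (w x)\<^sup>2 \<partial>lborel) + (\<integral>x. (g x)\<^sup>2 \<partial>lborel)" .
  show "expectation (\<lambda>\<omega>. iexp (u * W \<omega> + (\<Sum>j\<in>J. v j * Z j \<omega>)))
      = expectation (\<lambda>\<omega>. iexp (u * W \<omega>)) * expectation (\<lambda>\<omega>. iexp (\<Sum>j\<in>J. v j * Z j \<omega>))"
    using wiener_pair_char[OF B wiener_pair_add[OF B UW G], of 1] wiener_pair_char[OF B W, of u]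
      wiener_pair_char[OF B G, of 1]
    by (simp add: norm exp_add[symmetric] diff_divide_distrib add_divide_distrib flip: of_real_mult
      of_real_add exp_of_real)
qed auto

section \<open>Conditional variances of Wiener integrals\<close>

lemma subalgebra_generated_algebra:
  assumes "\<And>j. j \<in> J \<Longrightarrow> random_variable borel (Z j)"
  shows "subalgebra M (generated_algebra J Z)"
proof -
  have V[measurable]: "(\<lambda>\<omega>. \<lambda>j\<in>J. Z j \<omega>) \<in> M \<rightarrow>\<^sub>M (\<Pi>\<^sub>M j\<in>J. borel)"
    using assms by measurable
  have sp: "(\<lambda>\<omega>. \<lambda>j\<in>J. Z j \<omega>) \<in> space M \<rightarrow> space (\<Pi>\<^sub>M j\<in>J. (borel :: real measure))"
    using measurable_space[OF V] by auto
  show ?thesis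
    unfolding subalgebra_def generated_algebra_def sets_vimage_algebra2[OF sp]
    by (auto intro: measurable_sets)
qed

text \<open>
  Project the kernel \<open>y\<close> on the span of the \<open>z j\<close>. The Wiener integral \<open>W\<close> of the residual is
  independent of the \<open>Z j\<close>. Hence the conditional expectation of \<open>Y\<close> is \<open>Y - W\<close>, and the conditional
  variance is the constant \<open>E W\<^sup>2\<close>, which is the squared norm of the residual kernel.
\<close>

lemma gaussian_cond_variance_wiener:
  assumes B: "brownian_motion B" and J: "finite J"
    and Z: "\<And>j. j \<in> J \<Longrightarrow> wiener_pair B (z j) (Z j)" and Y: "wiener_pair B y Y"
  obtains c where "gaussian_cond_variance J Z Y = (\<integral>x. (y x - (\<Sum>j\<in>J. c j * z j x))\<^sup>2 \<partial>lborel)"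
proof -
  have "\<exists>c. \<forall>i\<in>J. (\<integral>x. (y x - (\<Sum>j\<in>J. c j * z j x)) * z i x \<partial>lborel) = 0"
    by (intro orthogonal_residual_exists J wiener_pair_square_integrable[OF Z]
      wiener_pair_square_integrable[OF Y])
  then obtain c where c: "\<And>i. i \<in> J \<Longrightarrow> (\<integral>x. (y x - (\<Sum>j\<in>J. c j * z j x)) * z i x \<partial>lborel) = 0"
    by blast
  define w where "w x = y x - (\<Sum>j\<in>J. c j * z j x)" for x
  define P where "P \<omega> = (\<Sum>j\<in>J. c j * Z j \<omega>)" for \<omega>
  define W where "W \<omega> = Y \<omega> - P \<omega>" for \<omega>
  define v where "v = (\<integral>x. (w x)\<^sup>2 \<partial>lborel)"
  have P: "wiener_pair B (\<lambda>x. \<Sum>j\<in>J. c j * z j x) P"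
    unfolding P_def by (rule wiener_pair_sum[OF B Z])
  have W: "wiener_pair B w W"
    unfolding w_def W_def by (rule wiener_pair_diff[OF B Y P])
  note [measurable] = wiener_pair_measurable[OF Y] wiener_pair_measurable[OF P]
    wiener_pair_measurable[OF W]
  define F where "F = generated_algebra J Z"
  have sub: "subalgebra M F"
    unfolding F_def by (intro subalgebra_generated_algebra wiener_pair_measurable[OF Z])
  interpret F: finite_measure_subalgebra M F
    using sub by (simp add: finite_measure_subalgebra_def finite_measure_subalgebra_axioms_def
      finite_measure_axioms)
  let ?V = "\<lambda>\<omega>. \<lambda>j\<in>J. Z j \<omega>" and ?S = "\<Pi>\<^sub>M j\<in>J. (borel :: real measure)"
  have V: "?V \<in> M \<rightarrow>\<^sub>M ?S" using wiener_pair_measurable[OF Z] by measurable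
  have Vsp: "?V \<in> space M \<rightarrow> space ?S" using measurable_space[OF V] by auto
  have VF: "?V \<in> F \<rightarrow>\<^sub>M ?S"
    unfolding F_def generated_algebra_def by (rule measurable_vimage_algebra1[OF Vsp])
  have PF: "P \<in> borel_measurable F"
  proof -
    have "(\<lambda>\<omega>. \<Sum>j\<in>J. c j * (?V \<omega>) j) \<in> borel_measurable F"
      by (intro borel_measurable_sum borel_measurable_times borel_measurable_const
          measurable_compose[OF VF measurable_component_singleton])
    also have "(\<lambda>\<omega>. \<Sum>j\<in>J. c j * (?V \<omega>) j) = P"
      by (auto simp: P_def fun_eq_iff intro!: sum.cong)
    finally show ?thesis .
  qed
  have repr: "\<exists>C\<in>sets ?S. \<forall>\<omega>\<in>space M. indicator A \<omega> = (indicator C (?V \<omega>) :: real)" if "A \<in> sets F"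
    for A
    using that unfolding F_def generated_algebra_def sets_vimage_algebra2[OF Vsp]
    by (auto simp: indicator_def)
  have indep: "expectation (\<lambda>\<omega>. indicator A \<omega> * h (W \<omega>))
    = expectation (\<lambda>\<omega>. indicator A \<omega>) * expectation (\<lambda>\<omega>. h (W \<omega>))"
    if A: "A \<in> sets F" and h: "h \<in> borel_measurable borel" "integrable M (\<lambda>\<omega>. h (W \<omega>))"
      for A and h :: "real \<Rightarrow> real"
  proof -
    obtain C where C[measurable]: "C \<in> sets ?S"
      and AC: "\<And>\<omega>. \<omega> \<in> space M \<Longrightarrow> indicator A \<omega> = (indicator C (?V \<omega>) :: real)"
      using repr[OF A] by blast
    have "indep_var borel W borel (\<lambda>\<omega>. indicator C (?V \<omega>) :: real)"
      using c by (intro wiener_pair_orthogonal_indep[OF B J Z W]) (auto simp: w_def)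
    then have i: "indep_var borel (h \<circ> W) borel ((\<lambda>x. x) \<circ> (\<lambda>\<omega>. indicator C (?V \<omega>) :: real))"
      by (rule indep_var_compose) (use h in auto)
    have "integrable M (\<lambda>\<omega>. indicator C (?V \<omega>) :: real)"
      using measurable_compose[OF V borel_measurable_indicator[OF C]]
      by (intro integrable_const_bound[of _ 1]) (auto simp: indicator_def)
    then have "expectation (\<lambda>\<omega>. h (W \<omega>) * indicator C (?V \<omega>))
      = expectation (\<lambda>\<omega>. h (W \<omega>)) * expectation (\<lambda>\<omega>. indicator C (?V \<omega>))"
      using indep_var_lebesgue_integral[OF i] h by (simp add: comp_def)
    then show ?thesis
      using AC by (simp add: mult.commute cong: Bochner_Integration.integral_cong)
  qed
  have A_M: "A \<in> sets M" if "A \<in> sets F" for A using sub that by (auto simp: subalgebra_def)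
  note WG = wiener_pair_gaussian[OF B W] and YG = wiener_pair_gaussian[OF B Y] and PG
    = wiener_pair_gaussian[OF B P]
  have cond: "AE \<omega> in M. real_cond_exp M F Y \<omega> = P \<omega>"
  proof (rule F.real_cond_exp_charact)
    fix A assume A: "A \<in> sets F"
    have "(\<integral>\<omega>\<in>A. Y \<omega> \<partial>M) = expectation (\<lambda>\<omega>. indicator A \<omega> * W \<omega> + indicator A \<omega> * P \<omega>)"
      by (simp add: set_lebesgue_integral_def W_def algebra_simps)
    also have "\<dots> = expectation (\<lambda>\<omega>. indicator A \<omega> * W \<omega>) + expectation (\<lambda>\<omega>. indicator A \<omega> * P \<omega>)"
      using integrable_mult_indicator[OF A_M[OF A] WG(2)] integrable_mult_indicator[OF A_M[OF A] PG(2)]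
      by simp
    also have "expectation (\<lambda>\<omega>. indicator A \<omega> * W \<omega>) = 0"
      using indep[OF A, of "\<lambda>x. x"] WG by simp
    finally show "(\<integral>\<omega>\<in>A. Y \<omega> \<partial>M) = (\<integral>\<omega>\<in>A. P \<omega> \<partial>M)"
      by (simp add: set_lebesgue_integral_def)
  qed (use YG PG PF in auto)
  have cond2: "AE \<omega> in M. real_cond_exp M F (\<lambda>\<omega>. (W \<omega>)\<^sup>2) \<omega> = v"
  proof (rule F.real_cond_exp_charact)
    fix A assume A: "A \<in> sets F"
    show "(\<integral>\<omega>\<in>A. (W \<omega>)\<^sup>2 \<partial>M) = (\<integral>\<omega>\<in>A. v \<partial>M)"
      using indep[OF A, of "\<lambda>x. x\<^sup>2"] WG by (simp add: set_lebesgue_integral_def v_def)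
  qed (use WG in auto)
  have "AE \<omega> in M. (Y \<omega> - real_cond_exp M F Y \<omega>)\<^sup>2 = (W \<omega>)\<^sup>2"
    using cond by (auto simp: W_def)
  then have "AE \<omega> in M. cond_variance F Y \<omega> = real_cond_exp M F (\<lambda>\<omega>. (W \<omega>)\<^sup>2) \<omega>"
    unfolding cond_variance_def by (intro F.real_cond_exp_cong) auto
  with cond2 have ae: "AE \<omega> in M. cond_variance F Y \<omega> = v" by auto
  have "gaussian_cond_variance J Z Y = v"
    unfolding gaussian_cond_variance_def F_def[symmetric]
  proof (rule the_equality[where P="\<lambda>v. AE \<omega> in M. cond_variance F Y \<omega> = v", OF ae])
    fix v' assume "AE \<omega> in M. cond_variance F Y \<omega> = v'"
    with ae have "AE \<omega> in M. v' = v" by eventually_elim simp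
    then show "v' = v" by simp
  qed
  then show ?thesis using that[of c] by (simp add: v_def w_def)
qed

end

section \<open>Energy estimates for the logarithmic kernel\<close>

text \<open>
  The weight \<open>1 / u\<close> is the derivative of the logarithm and makes the powers of \<open>ln (r / u)\<close>
  explicitly integrable. For \<open>\<gamma> < 1\<close> the integrand is unbounded near \<open>r\<close>, and for \<open>q = r\<close> the
  integral is improper there; the antiderivative tends to \<open>0\<close> because \<open>\<gamma> > 0\<close>.
\<close>

lemma nn_integral_log_powr:
  fixes p q r \<gamma> :: real
  assumes "0 < p" "p < q" "q \<le> r" "0 < \<gamma>"
  shows "(\<integral>\<^sup>+u. ennreal (ln (r / u) powr (\<gamma> - 1) / u * indicator {p<..<q} u) \<partial>lborel)
    = ennreal ((ln (r / p) powr \<gamma> - ln (r / q) powr \<gamma>) / \<gamma>)"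
proof -
  define F where "F u = - (ln (r / u) powr \<gamma>) / \<gamma>" for u
  define f where "f u = ln (r / u) powr (\<gamma> - 1) / u" for u
  have lnpos: "ln (r / u) > 0" if "p < u" "u < q" for u
    using that assms by (auto intro!: ln_gt_zero)
  have F': "DERIV F u :> f u" if "p < u" "u < q" for u
    unfolding F_def f_def using lnpos[OF that] assms that
    by (auto intro!: derivative_eq_intros simp: field_simps powr_diff)
  have f': "isCont f u" if "p < u" "u < q" for u
    unfolding f_def using lnpos[OF that] assms that
    by (intro continuous_intros) auto
  have "isCont F p"
    unfolding F_def using assms by (intro continuous_intros) auto
  then have Fp: "(F \<longlongrightarrow> F p) (at_right p)"
    using isCont_def tendsto_within_subset filterlim_at_split by blast
  have Fq: "(F \<longlongrightarrow> F q) (at_left q)"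
  proof (cases "q = r")
    case False
    then have "isCont F q"
      unfolding F_def using assms by (intro continuous_intros) auto
    then show ?thesis
      using isCont_def filterlim_at_split by blast
  next
    case True
    have "((\<lambda>u. ln (r/u)) \<longlongrightarrow> ln (r / r)) (at_left r)"
      using assms by (intro tendsto_intros) auto
    moreover have "\<forall>\<^sub>F u in at_left r. 0 \<le> ln (r/u)"
      using eventually_at_left_real[of p r] assms True
      by (auto elim!: eventually_mono)
    ultimately have "((\<lambda>u. - (ln (r/u) powr \<gamma>) / \<gamma>) \<longlongrightarrow> - (ln (r/r) powr \<gamma>) / \<gamma>) (at_left r)"
      using assms True by (intro tendsto_intros tendsto_powr2) auto
    then show ?thesis using True by (simp add: F_def[abs_def])
  qed
  have nn: "AE x in lborel. ereal p < ereal x \<longrightarrow> ereal x < ereal q \<longrightarrow> 0 \<le> f x"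
    using assms by (auto simp: f_def)
  have lims: "((F \<circ> real_of_ereal) \<longlongrightarrow> F p) (at_right (ereal p))"
      "((F \<circ> real_of_ereal) \<longlongrightarrow> F q) (at_left (ereal q))"
    using Fp Fq by (simp_all only: ereal_tendsto_simps1 ereal_tendsto_simps)
  have le: "ereal p < ereal q" using assms by simp
  note FTC = interval_integral_FTC_nonneg[OF le _ _ nn lims]
  have I: "set_integrable lborel {p<..<q} f"
    using FTC(1) F' f' by simp
  have V: "(LBINT x:{p<..<q}. f x) = F q - F p"
    using FTC(2) F' f' assms by (simp add: interval_lebesgue_integral_def)
  have "(\<integral>\<^sup>+u. ennreal (f u * indicator {p<..<q} u) \<partial>lborel) = ennreal (F q - F p)"
    using I V assms unfolding set_integrable_def set_lebesgue_integral_def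
    by (subst nn_integral_eq_integral)
       (auto simp: mult.commute f_def indicator_def intro!: AE_I2 divide_nonneg_nonneg)
  then show ?thesis by (simp add: f_def F_def diff_divide_distrib)
qed

text \<open>
  For a negative exponent it is the endpoint \<open>0\<close>, where \<open>ln (r / u)\<close> tends to infinity, at which the
  antiderivative vanishes.
\<close>

lemma nn_integral_log_powr_zero:
  fixes q r \<gamma> :: real
  assumes "0 < q" "q < r" "\<gamma> < 0"
  shows "(\<integral>\<^sup>+u. ennreal (ln (r / u) powr (\<gamma> - 1) / u * indicator {0<..<q} u) \<partial>lborel)
    = ennreal (ln (r / q) powr \<gamma> / (- \<gamma>))"
proof -
  define F where "F u = - (ln (r / u) powr \<gamma>) / \<gamma>" for u
  define f where "f u = ln (r / u) powr (\<gamma> - 1) / u" for u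
  have lnpos: "ln (r / u) > 0" if "0 < u" "u < q" for u
    using that assms by (auto intro!: ln_gt_zero)
  have F': "DERIV F u :> f u" if "0 < u" "u < q" for u
    unfolding F_def f_def using lnpos[OF that] assms that
    by (auto intro!: derivative_eq_intros simp: field_simps powr_diff)
  have f': "isCont f u" if "0 < u" "u < q" for u
    unfolding f_def using lnpos[OF that] assms that
    by (intro continuous_intros) auto
  have Fp: "(F \<longlongrightarrow> 0) (at_right 0)"
    unfolding F_def using assms by real_asymp
  have "isCont F q"
    unfolding F_def using assms by (intro continuous_intros) auto
  then have Fq: "(F \<longlongrightarrow> F q) (at_left q)"
    using isCont_def filterlim_at_split by blast
  have nn: "AE x in lborel. ereal 0 < ereal x \<longrightarrow> ereal x < ereal q \<longrightarrow> 0 \<le> f x"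
    using assms by (auto simp: f_def)
  have lims: "((F \<circ> real_of_ereal) \<longlongrightarrow> 0) (at_right (ereal 0))"
      "((F \<circ> real_of_ereal) \<longlongrightarrow> F q) (at_left (ereal q))"
    using Fp Fq by (simp_all only: ereal_tendsto_simps1 ereal_tendsto_simps)
  have le: "ereal 0 < ereal q" using assms by simp
  note FTC = interval_integral_FTC_nonneg[OF le _ _ nn lims]
  have I: "set_integrable lborel {0<..<q} f"
    using FTC(1) F' f' einterval_eq_Icc[of 0 q] unfolding zero_ereal_def by simp
  have V: "(LBINT x:{0<..<q}. f x) = F q - 0"
    using FTC(2) F' f' assms einterval_eq_Icc[of 0 q] unfolding zero_ereal_def
    by (simp add: interval_lebesgue_integral_def)
  have "(\<integral>\<^sup>+u. ennreal (f u * indicator {0<..<q} u) \<partial>lborel) = ennreal (F q)"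
    using I V assms unfolding set_integrable_def set_lebesgue_integral_def
    by (subst nn_integral_eq_integral)
       (auto simp: mult.commute f_def indicator_def intro!: AE_I2 divide_nonneg_nonneg)
  then show ?thesis by (simp add: f_def F_def)
qed

definition hadamard_kernel :: "real \<Rightarrow> real \<Rightarrow> real \<Rightarrow> real" where
  "hadamard_kernel \<alpha> t x =
     1 / sqrt (Gamma \<alpha>) * (indicator {0..t} x * ln (t / x) powr ((\<alpha> - 1) / 2))"

lemma hadamard_kernel_eq_0: "t \<le> x \<Longrightarrow> hadamard_kernel \<alpha> t x = 0" "x \<le> 0 \<Longrightarrow> hadamard_kernel \<alpha> t x = 0"
  by (cases "x = t"; cases "t = 0"; auto simp: hadamard_kernel_def indicator_def)+

lemma hadamard_kernel_square:
  assumes "0 < \<alpha>" "0 < x" "x < t"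
  shows "(hadamard_kernel \<alpha> t x)\<^sup>2 = ln (t / x) powr (\<alpha> - 1) / Gamma \<alpha>"
proof -
  have "0 < Gamma \<alpha>" using assms by (intro Gamma_real_pos)
  moreover have "(ln (t / x) powr ((\<alpha> - 1) / 2))\<^sup>2 = ln (t / x) powr (\<alpha> - 1)"
    by (simp add: power2_eq_square flip: powr_add)
  ultimately show ?thesis
    using assms by (simp add: hadamard_kernel_def power_divide)
qed

text \<open>
  The mean value theorem; the derivative of \<open>z powr \<beta>\<close> is largest in absolute value at the left end,
  as \<open>\<beta> < 1\<close>.
\<close>

lemma powr_increment_bound:
  fixes y h \<beta> :: real
  assumes "0 < y" "0 < h" "\<beta> < 1"
  shows "\<bar>(y + h) powr \<beta> - y powr \<beta>\<bar> \<le> \<bar>\<beta>\<bar> * h * y powr (\<beta> - 1)"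
proof -
  have "\<exists>z. y < z \<and> z < y + h \<and> (y + h) powr \<beta> - y powr \<beta> = (y + h - y) * (\<beta> * z powr (\<beta> - 1))"
    using assms by (intro MVT2) (auto intro!: derivative_eq_intros)
  then obtain z where z: "y < z" "(y + h) powr \<beta> - y powr \<beta> = h * (\<beta> * z powr (\<beta> - 1))" by auto
  have "z powr (\<beta> - 1) \<le> y powr (\<beta> - 1)"
    using assms z by (intro powr_mono2') auto
  then show ?thesis
    using assms unfolding z(2) by (simp add: abs_mult mult_ac mult_left_mono)
qed

text \<open>
  On \<open>(s, t)\<close> the weight \<open>s / x\<close> is at most \<open>1\<close>, and with this weight the square of the kernel has an
  explicit integral.
\<close>

lemma hadamard_kernel_innovation_lower:
  assumes \<alpha>: "0 < \<alpha>" and st: "0 < s" "s < t"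
  shows "ennreal (s * ln (t / s) powr \<alpha> / (\<alpha> * Gamma \<alpha>))
    \<le> (\<integral>\<^sup>+x. ennreal ((hadamard_kernel \<alpha> t x)\<^sup>2 * indicator {s<..<t} x) \<partial>lborel)"
proof -
  have G: "0 < Gamma \<alpha>" using \<alpha> by (rule Gamma_real_pos)
  have "ennreal (s * ln (t / s) powr \<alpha> / (\<alpha> * Gamma \<alpha>))
    = ennreal (s / Gamma \<alpha>) * ennreal ((ln (t / s) powr \<alpha> - ln (t / t) powr \<alpha>) / \<alpha>)"
    using assms G by (simp add: ennreal_mult[symmetric] field_simps)
  also have "\<dots> = ennreal (s / Gamma \<alpha>)
    * (\<integral>\<^sup>+x. ennreal (ln (t / x) powr (\<alpha> - 1) / x * indicator {s<..<t} x) \<partial>lborel)"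
    using assms by (subst nn_integral_log_powr) auto
  also have "\<dots> = (\<integral>\<^sup>+x. ennreal (s / Gamma \<alpha>)
    * ennreal (ln (t / x) powr (\<alpha> - 1) / x * indicator {s<..<t} x) \<partial>lborel)"
    by (rule nn_integral_cmult[symmetric]) measurable
  also have "\<dots> \<le> (\<integral>\<^sup>+x. ennreal ((hadamard_kernel \<alpha> t x)\<^sup>2 * indicator {s<..<t} x) \<partial>lborel)"
  proof (intro nn_integral_mono)
    fix x :: real
    show "ennreal (s / Gamma \<alpha>) * ennreal (ln (t / x) powr (\<alpha> - 1) / x * indicator {s<..<t} x)
        \<le> ennreal ((hadamard_kernel \<alpha> t x)\<^sup>2 * indicator {s<..<t} x)"
    proof (cases "x \<in> {s<..<t}")
      case True
      then have "s / x \<le> 1" using st by simp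
      then have "(s / x) * (ln (t / x) powr (\<alpha> - 1) / Gamma \<alpha>)
        \<le> 1 * (ln (t / x) powr (\<alpha> - 1) / Gamma \<alpha>)"
        using G by (intro mult_right_mono) auto
      then show ?thesis
        using True st \<alpha> G by (simp add: hadamard_kernel_square ennreal_mult[symmetric] mult_ac
          ennreal_leI)
    qed simp
  qed
  finally show ?thesis .
qed

text \<open>
  On \<open>(0, s)\<close> the weight \<open>s / x\<close> is at least \<open>1\<close>. Put \<open>y = ln (s / x)\<close>, \<open>h = ln (t / s)\<close> and
  \<open>\<beta> = (\<alpha> - 1) / 2\<close>; the kernels at \<open>x\<close> are then \<open>(y + h) powr \<beta>\<close> and \<open>y powr \<beta>\<close> up to the common
  factor. For \<open>y < h\<close> the square of their difference is bounded by the sum of their squares, whose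
  weighted integral is of order \<open>h powr \<alpha>\<close> as \<open>\<alpha> > 0\<close>. For \<open>y > h\<close> it is bounded by
  \<open>\<beta>\<^sup>2 h\<^sup>2 y powr (\<alpha> - 3)\<close>, whose weighted integral over \<open>y > h\<close> is again of order \<open>h powr \<alpha>\<close>, as
  \<open>\<alpha> < 2\<close>. The second factor of the bound is the lower bound for the innovation in
  \<open>hadamard_kernel_innovation_lower\<close>.
\<close>

lemma hadamard_kernel_past_upper:
  assumes \<alpha>: "0 < \<alpha>" "\<alpha> < 2" and st: "0 < s" "s < t"
  shows "(\<integral>\<^sup>+x. ennreal ((hadamard_kernel \<alpha> t x - hadamard_kernel \<alpha> s x)\<^sup>2
    * indicator {0<..<s} x) \<partial>lborel)
    \<le> ennreal ((2 powr \<alpha> + \<alpha> * ((\<alpha> - 1) / 2)\<^sup>2 / (2 - \<alpha>)) * (s * ln (t / s) powr \<alpha> / (\<alpha> * Gamma \<alpha>)))"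
proof -
  define \<beta> where "\<beta> = (\<alpha> - 1) / 2"
  define h where "h = ln (t / s)"
  \<comment> \<open>the point at which \<open>ln (s / x) = h\<close>\<close>
  define p where "p = s\<^sup>2 / t"
  define c where "c = s / Gamma \<alpha>"
  have G: "0 < Gamma \<alpha>" using \<alpha> by (intro Gamma_real_pos)
  have h: "0 < h" using st by (simp add: h_def)
  have p: "0 < p" "p < s" using st by (auto simp: p_def power2_eq_square field_simps)
  have c: "0 < c" using st G by (simp add: c_def)
  have ln_sp: "ln (s / p) = h" using st by (simp add: p_def h_def power2_eq_square)
  have ln_tp: "ln (t / p) = 2 * h"
    using st by (simp add: p_def h_def ln_div ln_mult power2_eq_square)
  have ln_t: "ln (t / x) = ln (s / x) + h" if "0 < x" for x
    using that st by (simp add: h_def ln_div)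
  define b1 where "b1 x = ln (t / x) powr (\<alpha> - 1) / x * indicator {p<..<s} x" for x
  define b2 where "b2 x = ln (s / x) powr (\<alpha> - 1) / x * indicator {p<..<s} x" for x
  define b3 where "b3 x = ln (s / x) powr (\<alpha> - 2 - 1) / x * indicator {0<..<p} x" for x
  have [measurable]: "b1 \<in> borel_measurable borel" "b2 \<in> borel_measurable borel"
    "b3 \<in> borel_measurable borel"
    unfolding b1_def b2_def b3_def by measurable
  have b: "0 \<le> b1 x" "0 \<le> b2 x" "0 \<le> b3 x" for x
    using p by (auto simp: b1_def b2_def b3_def indicator_def)
  have I1: "(\<integral>\<^sup>+x. ennreal (b1 x) \<partial>lborel) = ennreal (((2 * h) powr \<alpha> - h powr \<alpha>) / \<alpha>)"
    unfolding b1_def using p st \<alpha> by (subst nn_integral_log_powr) (auto simp: ln_tp h_def)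
  have I2: "(\<integral>\<^sup>+x. ennreal (b2 x) \<partial>lborel) = ennreal (h powr \<alpha> / \<alpha>)"
    unfolding b2_def using p st \<alpha> by (subst nn_integral_log_powr) (auto simp: ln_sp)
  have I3: "(\<integral>\<^sup>+x. ennreal (b3 x) \<partial>lborel) = ennreal (h powr (\<alpha> - 2) / (2 - \<alpha>))"
    unfolding b3_def using p st \<alpha> by (subst nn_integral_log_powr_zero) (auto simp: ln_sp)
  have "(\<integral>\<^sup>+x. ennreal ((hadamard_kernel \<alpha> t x - hadamard_kernel \<alpha> s x)\<^sup>2
    * indicator {0<..<s} x) \<partial>lborel)
      \<le> (\<integral>\<^sup>+x. ennreal c * (ennreal (b1 x) + ennreal (b2 x) + ennreal (\<beta>\<^sup>2 * h\<^sup>2)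
        * ennreal (b3 x)) \<partial>lborel)"
  proof (rule nn_integral_mono_AE)
    show "AE x in lborel. ennreal ((hadamard_kernel \<alpha> t x - hadamard_kernel \<alpha> s x)\<^sup>2
      * indicator {0<..<s} x)
      \<le> ennreal c * (ennreal (b1 x) + ennreal (b2 x) + ennreal (\<beta>\<^sup>2 * h\<^sup>2) * ennreal (b3 x))"
      using AE_lborel_singleton[of p]
    proof (eventually_elim)
      case (elim x)
      have "(hadamard_kernel \<alpha> t x - hadamard_kernel \<alpha> s x)\<^sup>2 * indicator {0<..<s} x
        \<le> c * (b1 x + b2 x + (\<beta>\<^sup>2 * h\<^sup>2) * b3 x)"
      proof (cases "x \<in> {0<..<s}")
        case False
        then show ?thesis using b[of x] c by simp
      next
        case True
        define y where "y = ln (s / x)"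
        have y: "0 < y" using True by (simp add: y_def)
        have ty: "ln (t / x) = y + h" using ln_t[of x] True by (simp add: y_def)
        have K: "hadamard_kernel \<alpha> t x - hadamard_kernel \<alpha> s x
          = ((y + h) powr \<beta> - y powr \<beta>) / sqrt (Gamma \<alpha>)"
          using True st by (simp add: hadamard_kernel_def \<beta>_def ty y_def[symmetric] diff_divide_distrib)
        have K2: "(hadamard_kernel \<alpha> t x - hadamard_kernel \<alpha> s x)\<^sup>2
          = ((y + h) powr \<beta> - y powr \<beta>)\<^sup>2 / Gamma \<alpha>"
          unfolding K using G by (simp add: power_divide)
        have weight: "a / Gamma \<alpha> \<le> c * (a / x)" if "0 \<le> a" for a
        proof -
          have "(a / Gamma \<alpha>) * 1 \<le> (a / Gamma \<alpha>) * (s / x)"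
            using that True G by (intro mult_left_mono) auto
          then show ?thesis by (simp add: c_def mult_ac)
        qed
        have sq: "(z powr \<beta>)\<^sup>2 = z powr (\<alpha> - 1)" for z :: real
          by (simp add: power2_eq_square \<beta>_def flip: powr_add)
        show ?thesis
        proof (cases "p < x")
          case near: True
          have "((y + h) powr \<beta> - y powr \<beta>)\<^sup>2 \<le> ((y + h) powr \<beta>)\<^sup>2 + (y powr \<beta>)\<^sup>2"
            by (simp add: power2_diff)
          then have "(hadamard_kernel \<alpha> t x - hadamard_kernel \<alpha> s x)\<^sup>2
            \<le> ((y + h) powr (\<alpha> - 1) + y powr (\<alpha> - 1)) / Gamma \<alpha>"
            unfolding K2 sq using G by (intro divide_right_mono) auto
          also have "\<dots> \<le> c * (((y + h) powr (\<alpha> - 1) + y powr (\<alpha> - 1)) / x)"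
            by (rule weight) simp
          finally show ?thesis
            using True near by (simp add: b1_def b2_def b3_def ty y_def[symmetric] add_divide_distrib)
        next
          case far: False
          have "\<beta> < 1" using \<alpha> by (simp add: \<beta>_def)
          have "((y + h) powr \<beta> - y powr \<beta>)\<^sup>2 \<le> (\<bar>\<beta>\<bar> * h * y powr (\<beta> - 1))\<^sup>2"
            using power_mono[OF powr_increment_bound[OF y h \<open>\<beta> < 1\<close>], of 2] by simp
          also have "\<dots> = \<beta>\<^sup>2 * h\<^sup>2 * y powr (\<alpha> - 2 - 1)"
          proof -
            have "(y powr (\<beta> - 1))\<^sup>2 = y powr (\<alpha> - 2 - 1)"
              by (simp add: power2_eq_square \<beta>_def flip: powr_add)
            then show ?thesis by (simp add: power_mult_distrib)
          qed
          finally have "(hadamard_kernel \<alpha> t x - hadamard_kernel \<alpha> s x)\<^sup>2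
            \<le> \<beta>\<^sup>2 * h\<^sup>2 * y powr (\<alpha> - 2 - 1) / Gamma \<alpha>"
            unfolding K2 using G by (intro divide_right_mono) auto
          also have "\<dots> \<le> c * (\<beta>\<^sup>2 * h\<^sup>2 * y powr (\<alpha> - 2 - 1) / x)"
            by (rule weight) simp
          finally show ?thesis
            using True far elim by (simp add: b1_def b2_def b3_def y_def[symmetric])
        qed
      qed
      then show ?case
        using b[of x] c h by (simp add: ennreal_mult[symmetric] ennreal_plus[symmetric] ennreal_leI
          del: ennreal_plus)
    qed
  qed
  also have "\<dots> = ennreal c * (ennreal (((2 * h) powr \<alpha> - h powr \<alpha>) / \<alpha>) + ennreal (h powr \<alpha> / \<alpha>)
      + ennreal (\<beta>\<^sup>2 * h\<^sup>2) * ennreal (h powr (\<alpha> - 2) / (2 - \<alpha>)))"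
    by (simp add: nn_integral_cmult nn_integral_add I1 I2 I3)
  also have "\<dots> = ennreal (c * (((2 * h) powr \<alpha> - h powr \<alpha>) / \<alpha> + h powr \<alpha> / \<alpha> + \<beta>\<^sup>2 * h\<^sup>2
    * (h powr (\<alpha> - 2) / (2 - \<alpha>))))"
  proof -
    have "h powr \<alpha> \<le> (2 * h) powr \<alpha>" using h \<alpha> by (intro powr_mono2) auto
    then have "0 \<le> ((2 * h) powr \<alpha> - h powr \<alpha>) / \<alpha>" using \<alpha> by simp
    then show ?thesis
      using c \<alpha> by (simp add: ennreal_mult[symmetric] ennreal_plus[symmetric] del: ennreal_plus)
  qed
  also have "c * (((2 * h) powr \<alpha> - h powr \<alpha>) / \<alpha> + h powr \<alpha> / \<alpha> + \<beta>\<^sup>2 * h\<^sup>2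
    * (h powr (\<alpha> - 2) / (2 - \<alpha>)))
      = (2 powr \<alpha> + \<alpha> * \<beta>\<^sup>2 / (2 - \<alpha>)) * (s * h powr \<alpha> / (\<alpha> * Gamma \<alpha>))"
  proof -
    have e1: "(2 * h) powr \<alpha> = 2 powr \<alpha> * h powr \<alpha>" using h by (simp add: powr_mult)
    have e2: "h\<^sup>2 * h powr (\<alpha> - 2) = h powr \<alpha>"
      using h by (simp add: powr_diff powr_numeral)
    have e3: "\<beta>\<^sup>2 * h\<^sup>2 * (h powr (\<alpha> - 2) / (2 - \<alpha>)) = \<beta>\<^sup>2 * h powr \<alpha> / (2 - \<alpha>)"
      using e2 by (simp add: mult.assoc)
    have ne: "2 - \<alpha> \<noteq> 0" "\<alpha> \<noteq> 0" using \<alpha> by auto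
    have neG: "Gamma \<alpha> \<noteq> 0" by (rule less_imp_neq[OF G, symmetric])
    have "c * (((2 * h) powr \<alpha> - h powr \<alpha>) / \<alpha> + h powr \<alpha> / \<alpha> + \<beta>\<^sup>2 * h\<^sup>2 * (h powr (\<alpha> - 2) / (2 - \<alpha>)))
      = c * (2 powr \<alpha> * h powr \<alpha> / \<alpha> + \<beta>\<^sup>2 * h powr \<alpha> / (2 - \<alpha>))"
      unfolding e3 e1 by (simp add: diff_divide_distrib)
    also have "\<dots> = (2 powr \<alpha> + \<alpha> * \<beta>\<^sup>2 / (2 - \<alpha>)) * (s * h powr \<alpha> / (\<alpha> * Gamma \<alpha>))"
      unfolding c_def using ne neG by (simp add: divide_simps) (simp add: algebra_simps)
    finally show ?thesis .
  qed
  finally show ?thesis by (simp add: \<beta>_def h_def)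
qed

text \<open>
  The variance of the part of \<open>X t\<close> that is driven by \<open>B\<close> on \<open>(s, t)\<close>.
\<close>

definition innovation_energy :: "real \<Rightarrow> real \<Rightarrow> real \<Rightarrow> real" where
  "innovation_energy \<alpha> s t = (\<integral>x. (hadamard_kernel \<alpha> t x)\<^sup>2 * indicator {s<..<t} x \<partial>lborel)"

lemma innovation_energy_nn:
  assumes "square_integrable lborel (hadamard_kernel \<alpha> t)"
  shows "ennreal (innovation_energy \<alpha> s t)
    = (\<integral>\<^sup>+x. ennreal ((hadamard_kernel \<alpha> t x)\<^sup>2 * indicator {s<..<t} x) \<partial>lborel)"
    and "integrable lborel (\<lambda>x. (hadamard_kernel \<alpha> t x)\<^sup>2 * indicator {s<..<t} x)"
proof -
  show i: "integrable lborel (\<lambda>x. (hadamard_kernel \<alpha> t x)\<^sup>2 * indicator {s<..<t} x)"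
    using assms by (intro integrable_real_mult_indicator) (auto simp: square_integrable_def)
  show "ennreal (innovation_energy \<alpha> s t)
    = (\<integral>\<^sup>+x. ennreal ((hadamard_kernel \<alpha> t x)\<^sup>2 * indicator {s<..<t} x) \<partial>lborel)"
    unfolding innovation_energy_def using i by (subst nn_integral_eq_integral) auto
qed

lemma innovation_energy_pos:
  assumes "0 < \<alpha>" "0 < s" "s < t" "square_integrable lborel (hadamard_kernel \<alpha> t)"
  shows "0 < innovation_energy \<alpha> s t"
proof -
  have "0 < ln (t / s)" using assms by simp
  then have "0 < s * ln (t / s) powr \<alpha> / (\<alpha> * Gamma \<alpha>)"
    using assms Gamma_real_pos[of \<alpha>] by simp
  moreover have "ennreal (s * ln (t / s) powr \<alpha> / (\<alpha> * Gamma \<alpha>)) \<le> ennreal (innovation_energy \<alpha> s t)"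
    using hadamard_kernel_innovation_lower[OF assms(1-3)] assms(4) by (simp add: innovation_energy_nn)
  ultimately show ?thesis
    by (metis ennreal_less_zero_iff less_le_trans)
qed

lemma innovation_energy_le_square_integral:
  assumes "square_integrable lborel (hadamard_kernel \<alpha> t)" "square_integrable lborel w"
    and "\<And>x. s < x \<Longrightarrow> x < t \<Longrightarrow> w x = hadamard_kernel \<alpha> t x"
  shows "innovation_energy \<alpha> s t \<le> (\<integral>x. (w x)\<^sup>2 \<partial>lborel)"
  unfolding innovation_energy_def
  using assms(2,3) innovation_energy_nn(2)[OF assms(1)]
  by (intro integral_mono) (auto simp: square_integrable_def indicator_def)

text \<open>
  The increment from \<open>s\<close> to \<open>t\<close> consists of the innovation on \<open>(s, t)\<close> and of the change of the
  kernel on \<open>(0, s)\<close>. By self-similarity both energies scale like \<open>s\<close> and depend otherwise only on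
  \<open>t / s\<close>, which is why the constant can be uniform in \<open>s\<close> and \<open>t\<close>, even near \<open>0\<close>.
\<close>

lemma hadamard_increment_le_innovation:
  assumes \<alpha>: "0 < \<alpha>" "\<alpha> < 2" and st: "0 < s" "s < t"
    and sq: "square_integrable lborel (hadamard_kernel \<alpha> s)"
      "square_integrable lborel (hadamard_kernel \<alpha> t)"
  shows "(\<integral>x. (hadamard_kernel \<alpha> t x - hadamard_kernel \<alpha> s x)\<^sup>2 \<partial>lborel)
    \<le> (1 + 2 powr \<alpha> + \<alpha> * ((\<alpha> - 1) / 2)\<^sup>2 / (2 - \<alpha>)) * innovation_energy \<alpha> s t"
proof -
  let ?K = "hadamard_kernel \<alpha>"
  define C where "C = 2 powr \<alpha> + \<alpha> * ((\<alpha> - 1) / 2)\<^sup>2 / (2 - \<alpha>)"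
  have C: "0 \<le> C" using \<alpha> by (simp add: C_def)
  define A where "A = innovation_energy \<alpha> s t"
  have A: "0 < A" unfolding A_def using \<alpha> st sq by (intro innovation_energy_pos)
  have [measurable]: "?K s \<in> borel_measurable borel" "?K t \<in> borel_measurable borel"
    using sq by (auto simp: square_integrable_def)
  have i: "square_integrable lborel (\<lambda>x. ?K t x - ?K s x)"
    using sq by (intro square_integrable_diff)
  have "ennreal (\<integral>x. (?K t x - ?K s x)\<^sup>2 \<partial>lborel) = (\<integral>\<^sup>+x. ennreal ((?K t x - ?K s x)\<^sup>2) \<partial>lborel)"
    using i by (subst nn_integral_eq_integral) (auto simp: square_integrable_def)
  also have "\<dots> = (\<integral>\<^sup>+x. ennreal ((?K t x)\<^sup>2 * indicator {s<..<t} x)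
    + ennreal ((?K t x - ?K s x)\<^sup>2 * indicator {0<..<s} x) \<partial>lborel)"
  proof (rule nn_integral_cong_AE)
    show "AE x in lborel. ennreal ((?K t x - ?K s x)\<^sup>2)
      = ennreal ((?K t x)\<^sup>2 * indicator {s<..<t} x)
        + ennreal ((?K t x - ?K s x)\<^sup>2 * indicator {0<..<s} x)"
      using AE_lborel_singleton[of s]
    proof (eventually_elim)
      case (elim x)
      consider "x \<le> 0" | "0 < x" "x < s" | "s < x" "x < t" | "t \<le> x" using elim by linarith
      then show ?case
        using st by cases (simp_all add: hadamard_kernel_eq_0)
    qed
  qed
  also have "\<dots> = (\<integral>\<^sup>+x. ennreal ((?K t x)\<^sup>2 * indicator {s<..<t} x) \<partial>lborel)
      + (\<integral>\<^sup>+x. ennreal ((?K t x - ?K s x)\<^sup>2 * indicator {0<..<s} x) \<partial>lborel)"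
    by (rule nn_integral_add) measurable
  also have "(\<integral>\<^sup>+x. ennreal ((?K t x)\<^sup>2 * indicator {s<..<t} x) \<partial>lborel) = ennreal A"
    using sq by (simp add: innovation_energy_nn A_def)
  also have "(\<integral>\<^sup>+x. ennreal ((?K t x - ?K s x)\<^sup>2 * indicator {0<..<s} x) \<partial>lborel) \<le> ennreal (C * A)"
  proof -
    have "(\<integral>\<^sup>+x. ennreal ((?K t x - ?K s x)\<^sup>2 * indicator {0<..<s} x) \<partial>lborel)
        \<le> ennreal (C * (s * ln (t / s) powr \<alpha> / (\<alpha> * Gamma \<alpha>)))"
      unfolding C_def by (rule hadamard_kernel_past_upper[OF \<alpha> st])
    also have "\<dots> \<le> ennreal (C * A)"
    proof -
      have "ennreal (s * ln (t / s) powr \<alpha> / (\<alpha> * Gamma \<alpha>)) \<le> ennreal A"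
        using hadamard_kernel_innovation_lower[OF \<alpha>(1) st] sq by (simp add: innovation_energy_nn A_def)
      then have "s * ln (t / s) powr \<alpha> / (\<alpha> * Gamma \<alpha>) \<le> A"
        using A by (subst (asm) ennreal_le_iff) auto
      then show ?thesis using C by (intro ennreal_leI mult_left_mono)
    qed
    finally show ?thesis .
  qed
  finally have "ennreal (\<integral>x. (?K t x - ?K s x)\<^sup>2 \<partial>lborel) \<le> ennreal (A + C * A)"
    using A C by (simp add: ennreal_plus)
  then have "(\<integral>x. (?K t x - ?K s x)\<^sup>2 \<partial>lborel) \<le> A + C * A"
    using A C by (subst (asm) ennreal_le_iff) auto
  then show ?thesis by (simp add: C_def A_def algebra_simps)
qed

section \<open>Local nondeterminism\<close>

context prob_space
begin

lemma hadamard_wiener_pair: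
  assumes B: "brownian_motion B" and X: "hadamard_fbm \<alpha> B X" and t: "0 \<le> t"
  shows "wiener_pair B (hadamard_kernel \<alpha> t) (X t)"
proof (cases "t = 0")
  case True
  have "hadamard_kernel \<alpha> t = (\<lambda>_. 0)" by (simp add: True hadamard_kernel_def fun_eq_iff)
  then show ?thesis using X True by (auto simp: hadamard_fbm_def intro!: wiener_pair_zero)
next
  case False
  then obtain Y where Y: "has_wiener_integral B (\<lambda>s. ln (t / s) powr ((\<alpha> - 1) / 2)) t Y"
    and XY: "\<And>\<omega>. \<omega> \<in> space M \<Longrightarrow> X t \<omega> = 1 / sqrt (Gamma \<alpha>) * Y \<omega>"
    using X t unfolding hadamard_fbm_def by (metis less_eq_real_def)
  show ?thesis
    unfolding hadamard_kernel_def[abs_def]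
    by (rule wiener_pair_scale[OF B wiener_pair_of_has_wiener_integral[OF B Y] XY])
qed

text \<open>
  The residual of \<open>X (\<tau> m) - X (\<tau> (m-1))\<close> after projection on \<open>X (\<tau> 1), \<dots>, X (\<tau> (m-1))\<close> has a
  kernel that agrees with the kernel of \<open>X (\<tau> m)\<close> on \<open>(\<tau> (m-1), \<tau> m)\<close>, because all the kernels that
  are subtracted vanish there. So the conditional variance is at least the innovation energy, and
  the energy estimate gives a bound that does not depend on \<open>m\<close> or on the tuple.
\<close>

lemma lnd_ratio_hadamard_lower:
  assumes B: "brownian_motion B" and X: "hadamard_fbm \<alpha> B X" and \<alpha>: "0 < \<alpha>" "\<alpha> < 2"
    and m: "2 \<le> m" and \<tau>: "strict_mono_on {1..m} \<tau>" "\<tau> ` {1..m} \<subseteq> {0<..}"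
  shows "1 / (1 + 2 powr \<alpha> + \<alpha> * ((\<alpha> - 1) / 2)\<^sup>2 / (2 - \<alpha>)) \<le> lnd_ratio X m \<tau>"
proof -
  let ?K = "hadamard_kernel \<alpha>"
  define C where "C = 1 + 2 powr \<alpha> + \<alpha> * ((\<alpha> - 1) / 2)\<^sup>2 / (2 - \<alpha>)"
  have "0 \<le> \<alpha> * ((\<alpha> - 1) / 2)\<^sup>2 / (2 - \<alpha>)" using \<alpha> by simp
  then have C: "0 < C" using powr_gt_zero[of 2 \<alpha>] unfolding C_def by linarith
  define s t where "s = \<tau> (m - 1)" and "t = \<tau> m"
  have st: "0 < s" "s < t"
    using \<tau> m strict_mono_onD[OF \<tau>(1), of "m - 1" m] by (auto simp: s_def t_def image_subset_iff)
  have pos: "0 < \<tau> j" if "j \<in> {1..m}" for j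
    using subsetD[OF \<tau>(2) imageI[OF that]] by simp
  have le: "\<tau> j \<le> s" if "j \<in> {1..m-1}" for j
  proof (cases "j = m - 1")
    case False
    then have "\<tau> j < \<tau> (m - 1)"
      using that m by (intro strict_mono_onD[OF \<tau>(1)]) auto
    then show ?thesis by (simp add: s_def)
  qed (simp add: s_def)
  have W: "wiener_pair B (?K r) (X r)" if "0 \<le> r" for r
    by (rule hadamard_wiener_pair[OF B X that])
  have sq: "square_integrable lborel (?K r)" if "0 \<le> r" for r
    by (rule wiener_pair_square_integrable[OF W[OF that]])
  have D: "wiener_pair B (\<lambda>x. ?K t x - ?K s x) (\<lambda>\<omega>. X t \<omega> - X s \<omega>)"
    using st by (intro wiener_pair_diff[OF B] W) auto
  have Z: "wiener_pair B (?K (\<tau> j)) (X (\<tau> j))" if "j \<in> {1..m-1}" for j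
  proof -
    have "j \<in> {1..m}" using that by auto
    then show ?thesis using pos[of j] by (intro W) simp
  qed
  obtain c where c: "gaussian_cond_variance {1..m-1} (\<lambda>j. X (\<tau> j)) (\<lambda>\<omega>. X t \<omega> - X s \<omega>)
      = (\<integral>x. (?K t x - ?K s x - (\<Sum>j\<in>{1..m-1}. c j * ?K (\<tau> j) x))\<^sup>2 \<partial>lborel)"
    by (rule gaussian_cond_variance_wiener[OF B finite_atLeastAtMost Z D])
  have num: "innovation_energy \<alpha> s t
    \<le> gaussian_cond_variance {1..m-1} (\<lambda>j. X (\<tau> j)) (\<lambda>\<omega>. X t \<omega> - X s \<omega>)"
    unfolding c
  proof (rule innovation_energy_le_square_integral)
    show "square_integrable lborel (?K t)" using st by (intro sq) auto
    show "square_integrable lborel (\<lambda>x. ?K t x - ?K s x - (\<Sum>j\<in>{1..m-1}. c j * ?K (\<tau> j) x))"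
      using wiener_pair_square_integrable[OF D] wiener_pair_square_integrable[OF Z]
      by (intro square_integrable_diff[OF _ square_integrable_sum])
    fix x assume x: "s < x" "x < t"
    have "?K (\<tau> j) x = 0" if "j \<in> {1..m-1}" for j
      using le[OF that] x by (intro hadamard_kernel_eq_0) auto
    then show "?K t x - ?K s x - (\<Sum>j\<in>{1..m-1}. c j * ?K (\<tau> j) x) = ?K t x"
      using x by (simp add: hadamard_kernel_eq_0)
  qed
  have A: "0 < innovation_energy \<alpha> s t" using \<alpha> st sq by (intro innovation_energy_pos) auto
  define V where "V = (\<integral>x. (?K t x - ?K s x)\<^sup>2 \<partial>lborel)"
  have V: "V \<le> C * innovation_energy \<alpha> s t"
    unfolding V_def C_def using \<alpha> st sq by (intro hadamard_increment_le_innovation) auto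
  have "innovation_energy \<alpha> s t \<le> V"
    unfolding V_def
    using st wiener_pair_square_integrable[OF D] sq
    by (intro innovation_energy_le_square_integral) (auto simp: hadamard_kernel_eq_0)
  then have Vpos: "0 < V" using A by simp
  have var: "variance (\<lambda>\<omega>. X t \<omega> - X s \<omega>) = V"
    using wiener_pair_gaussian(3,5)[OF B D] by (simp add: V_def)
  have "1 / C \<le> innovation_energy \<alpha> s t / V"
    using V Vpos C by (simp add: field_simps)
  also have "\<dots> \<le> lnd_ratio X m \<tau>"
    unfolding lnd_ratio_def s_def[symmetric] t_def[symmetric] var
    using num Vpos by (intro divide_right_mono) auto
  finally show ?thesis by (simp add: C_def)
qed

end

theorem theorem6p1:
  fixes M :: "'a measure" and B X :: "real \<Rightarrow> 'a \<Rightarrow> real" and \<alpha> T :: real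
  assumes "prob_space M"
    and "prob_space.brownian_motion M B"
    and "\<alpha> \<in> {0<..<1} \<union> {1<..<2}"
    and "prob_space.hadamard_fbm M \<alpha> B X"
    and "T > 0"
  shows "prob_space.locally_nondeterministic M {0..} X 0 T"
proof -
  interpret prob_space M by fact
  note B = assms(2) and X = assms(4)
  have \<alpha>: "0 < \<alpha>" "\<alpha> < 2" using assms(3) by auto
  have W: "wiener_pair B (hadamard_kernel \<alpha> r) (X r)" if "0 \<le> r" for r
    by (rule hadamard_wiener_pair[OF B X that])
  note sq = wiener_pair_square_integrable[OF W]
  have G: "gaussian_process {0..} X"
    unfolding gaussian_process_def
  proof (intro conjI ballI allI impI)
    show "random_variable borel (X t)" if "t \<in> {0..}" for t
      using that by (intro wiener_pair_measurable[OF W]) simp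
    fix J :: "real set" and c
    assume "finite J \<and> J \<subseteq> {0..}"
    then have "wiener_pair B (\<lambda>x. \<Sum>t\<in>J. c t * hadamard_kernel \<alpha> t x) (\<lambda>\<omega>. \<Sum>t\<in>J. c t * X t \<omega>)"
      by (intro wiener_pair_sum[OF B] W) auto
    then show "gaussian_rv (\<lambda>\<omega>. \<Sum>t\<in>J. c t * X t \<omega>)"
      by (rule wiener_pair_gaussian(1)[OF B])
  qed
  have pos: "0 < expectation (\<lambda>\<omega>. (X t \<omega>)\<^sup>2)" if t: "0 < t" for t
  proof -
    have "0 < innovation_energy \<alpha> (t / 2) t"
      using \<alpha> t sq by (intro innovation_energy_pos) auto
    also have "\<dots> \<le> (\<integral>x. (hadamard_kernel \<alpha> t x)\<^sup>2 \<partial>lborel)"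
      using t sq by (intro innovation_energy_le_square_integral) auto
    finally show ?thesis using wiener_pair_gaussian(5)[OF B W] t by simp
  qed
  have incr: "0 < expectation (\<lambda>\<omega>. (X t \<omega> - X s \<omega>)\<^sup>2)" if st: "0 < s" "s < t" for s t
  proof -
    have D: "wiener_pair B (\<lambda>x. hadamard_kernel \<alpha> t x - hadamard_kernel \<alpha> s x) (\<lambda>\<omega>. X t \<omega> - X s \<omega>)"
      using st by (intro wiener_pair_diff[OF B] W) auto
    have "0 < innovation_energy \<alpha> s t"
      using \<alpha> st sq by (intro innovation_energy_pos) auto
    also have "\<dots> \<le> (\<integral>x. (hadamard_kernel \<alpha> t x - hadamard_kernel \<alpha> s x)\<^sup>2 \<partial>lborel)"
      using st wiener_pair_square_integrable[OF D] sq
      by (intro innovation_energy_le_square_integral) (auto simp: hadamard_kernel_eq_0)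
    finally show ?thesis using wiener_pair_gaussian(5)[OF B D] by simp
  qed
  \<comment> \<open>Condition (ii) is symmetric in the two times, the previous estimate is for ordered ones.\<close>
  have incr': "0 < expectation (\<lambda>\<omega>. (X t \<omega> - X s \<omega>)\<^sup>2)" if "0 < s" "0 < t" "t \<noteq> s" for s t
    using incr[of s t] incr[of t s] that by (cases "s < t") (auto simp: power2_commute)
  define c where "c = 1 / (1 + 2 powr \<alpha> + \<alpha> * ((\<alpha> - 1) / 2)\<^sup>2 / (2 - \<alpha>))"
  have "0 \<le> \<alpha> * ((\<alpha> - 1) / 2)\<^sup>2 / (2 - \<alpha>)" using \<alpha> by simp
  then have c: "0 < c"
    using powr_gt_zero[of 2 \<alpha>] unfolding c_def by (intro divide_pos_pos) linarith+
  have lim: "0 < Liminf (at_right 0) (\<lambda>\<epsilon>. INF \<tau>\<in>close_tuples m 0 T \<epsilon>. ereal (lnd_ratio X m \<tau>))" if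
    m: "2 \<le> m" for m
  proof -
    have "ereal c \<le> Liminf (at_right 0) (\<lambda>\<epsilon>. INF \<tau>\<in>close_tuples m 0 T \<epsilon>. ereal (lnd_ratio X m \<tau>))"
    proof (intro Liminf_bounded always_eventually allI INF_greatest)
      fix \<epsilon> \<tau> assume "\<tau> \<in> close_tuples m 0 T \<epsilon>"
      then have \<tau>: "strict_mono_on {1..m} \<tau>" "\<tau> ` {1..m} \<subseteq> {0<..<T}"
        by (simp_all add: close_tuples_def)
      have "\<tau> ` {1..m} \<subseteq> {0<..}"
        by (rule order_trans[OF \<tau>(2)]) (simp add: subset_iff)
      then have "c \<le> lnd_ratio X m \<tau>"
        unfolding c_def by (rule lnd_ratio_hadamard_lower[OF B X \<alpha> m \<tau>(1)])
      then show "ereal c \<le> ereal (lnd_ratio X m \<tau>)" by simp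
    qed
    moreover have "0 < ereal c" using c by simp
    ultimately show ?thesis by (rule less_le_trans[rotated])
  qed
  show ?thesis
    unfolding locally_nondeterministic_def centered_gaussian_process_def
  proof (intro conjI ballI allI impI)
    show "expectation (X t) = 0" if "t \<in> {0..}" for t
      using that by (intro wiener_pair_gaussian(3)[OF B W]) simp
    show "0 < expectation (\<lambda>\<omega>. (X t \<omega>)\<^sup>2)" if "t \<in> {0<..<T}" for t
      using that by (intro pos) simp
    show "0 < expectation (\<lambda>\<omega>. (X t \<omega> - X s \<omega>)\<^sup>2)"
      if "t \<in> {0<..<T}" "s \<in> {0<..<T}" "t \<noteq> s" for s t
      using that by (intro incr') simp_all
    show "{0<..<T} \<subseteq> {0..}" by auto
  qed (fact G, rule lim)
qed

end
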